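(* Let $0<\mu<\nu$ be real numbers, and set $r_1=\max\{2,1+\mu\}$ and $r_2=\max\{2,1+\nu\}$. For $p\ge2$ define $$E_p=\begin{cases}\dfrac{(p-2)(r_1+r_2-2-\mu-\nu)}{4p}, & 2\le p\le 6,\\[6pt] \dfrac12+\dfrac{r_1+r_2-5-\mu-\nu}{p}, & p>6.\end{cases}$$ Then for every $p\ge2$ and every $\varepsilon>0$ there is a constant $C_{\mu,\nu,p,\varepsilon}>0$, depending only on $\mu,\nu,p,\varepsilon$, such that for every integer $N\ge1$ and all complex numbers $a_1,\dots,a_N$, $$\left\|\sum_{n=1}^N a_n e^{2\pi i(n^{1+\mu}x+n^{1+\nu}t)}\right\|_{L^p([0,1]^2)}\le C_{\mu,\nu,p,\varepsilon}\,N^{E_p+\varepsilon}\left(\sum_{n=1}^N|a_n|^2\right)^{\frac12}.$$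
   Context: The $L^p([0,1]^2)$ norm is taken in the real variables $(x,t)\in[0,1]^2$ with respect to Lebesgue measure. *)

theory Defs
  imports "HOL-Analysis.Analysis"
begin

definition unit_square :: "(real \<times> real) set" where
  "unit_square = {0..1} \<times> {0..1}"

text \<open>The Bochner integral is 0 on non-integrable functions, so this is the usual
  norm only if \<open>\<bar>f\<bar>\<^sup>p\<close> is integrable on the square. For the exponential sums below this is
  \<open>integrable_exp_sum\<close>.\<close>

definition Lp_norm_square :: "real \<Rightarrow> (real \<times> real \<Rightarrow> complex) \<Rightarrow> real" where
  "Lp_norm_square p f = (LINT z:unit_square|lborel. norm (f z) powr p) powr (1 / p)"

definition exp_sum :: "real \<Rightarrow> real \<Rightarrow> nat \<Rightarrow> (nat \<Rightarrow> complex) \<Rightarrow> real \<times> real \<Rightarrow> complex" where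
  "exp_sum \<mu> \<nu> N a = (\<lambda>(x, t). \<Sum>n = 1..N.
     a n * exp (2 * of_real pi * \<i> *
       of_real (real n powr (1 + \<mu>) * x + real n powr (1 + \<nu>) * t)))"

definition E_exponent :: "real \<Rightarrow> real \<Rightarrow> real \<Rightarrow> real" where
  "E_exponent \<mu> \<nu> p =
     (let r1 = max 2 (1 + \<mu>); r2 = max 2 (1 + \<nu>) in
      if p \<le> 6 then (p - 2) * (r1 + r2 - 2 - \<mu> - \<nu>) / (4 * p)
      else 1 / 2 + (r1 + r2 - 5 - \<mu> - \<nu>) / p)"

lemma integrable_exp_sum:
  assumes "p > 0"
  shows "set_integrable lborel unit_square (\<lambda>z. norm (exp_sum \<mu> \<nu> N a z) powr p)"
proof -
  have "compact unit_square"
    unfolding unit_square_def by (intro compact_Times compact_Icc)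
  moreover have "continuous_on unit_square (\<lambda>z. norm (exp_sum \<mu> \<nu> N a z) powr p)"
    unfolding exp_sum_def case_prod_unfold
    by (rule continuous_on_powr') (use assms in \<open>auto intro!: continuous_intros\<close>)
  ultimately show ?thesis
    unfolding set_integrable_def by (rule borel_integrable_compact)
qed

end

theory Submission
  imports Defs
begin

text \<open>
  By Hoelder's inequality it suffices to treat \<open>p = 2\<close>, \<open>p = 6\<close> and \<open>p = \<infinity>\<close>. The bound for \<open>p = 2\<close> is
  Parseval's identity after rounding the frequencies to integers.

  For \<open>p = 6\<close> consider \<open>n \<in> {M..<2 M}\<close>. Enlarging the square by the factors \<open>max 1 (M powr (1 - \<mu>))\<close> and
  \<open>max 1 (M powr (1 - \<nu>))\<close> accounts for \<open>E\<^sub>6\<close>, and on the enlarged square the curve is sufficiently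
  curved on the unit scale for an \<open>L\<^sup>6\<close> estimate with loss \<open>M powr \<epsilon>\<close>. This estimate follows by bilinear decoupling:
  for separated intervals \<open>I\<close> and \<open>J\<close>, transversality makes the pieces of \<open>f\<^sub>I\<close> of length about
  \<open>\<bar>J\<bar>\<^sup>2 / dist I J\<close> orthogonal with respect to the weight \<open>\<bar>f\<^sub>J\<bar>\<^sup>4\<close>. Exchanging the roles of the two
  functions by the Cauchy--Schwarz inequality and iterating gains in every step, so that an \<open>L\<^sup>6\<close> bound with
  exponent \<open>\<eta>\<close> implies one with a smaller exponent, as long as \<open>\<eta>\<close> is not below a given \<open>\<epsilon>\<close>. No
  rescaling of the curve is needed, since the transversality hypothesis is inherited by subintervals.
\<close>

section \<open>Bilinear decoupling for transversal systems\<close>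

text \<open>The frequencies are real, so characters on the unit square need not be orthogonal. After
  the enlargement they are rounded down to integers: the relevant integrals then vanish exactly, and
  the enlargement keeps the rounding errors below a constant times the curvature terms. Returning to
  real frequencies costs only a constant, since the fractional parts are bounded.

  The gain is a matter of counting powers of a parameter \<open>R\<close>. Put
  \<open>q = 2 ^ n\<close> and take two intervals of length and distance about \<open>R ^ q\<close>.
  Using an \<open>L\<^sup>6\<close> bound with exponent \<open>\<eta>\<close> directly costs
  \<open>R powr (\<eta> * q)\<close>, whereas \<open>n\<close> exchanges lower this exponent to
  \<open>\<eta> * (q - 1 - n / 2)\<close>. The reduction to such pairs costs \<open>R ^ 9\<close>
  whatever \<open>n\<close> is, so \<open>n * \<epsilon> \<ge> 18\<close> yields a net gain while
  \<open>\<eta> \<ge> \<epsilon>\<close>.\<close>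

lemma bounded_measurable_integrable:
  fixes g :: "'x \<Rightarrow> 'b :: {banach, second_countable_topology}"
  assumes "finite_measure M" "g \<in> borel_measurable M" "\<And>x. x \<in> space M \<Longrightarrow> norm (g x) \<le> B"
  shows "integrable M g"
  using finite_measure.integrable_const_bound[OF assms(1), of g B] assms by auto

lemma borel_measurable_cnj [measurable]:
  "g \<in> borel_measurable M \<Longrightarrow> (\<lambda>x. cnj (g x)) \<in> borel_measurable M"
  by (rule measurable_compose[OF _ borel_measurable_continuous_onI]) (auto intro: continuous_intros)

lemma integral_norm_sum_sq_orthogonal:
  fixes g :: "'k \<Rightarrow> 'x \<Rightarrow> complex" and v :: "'x \<Rightarrow> real"
  assumes "finite A"
    and int: "\<And>k l. k \<in> A \<Longrightarrow> l \<in> A \<Longrightarrow> integrable M (\<lambda>x. g k x * cnj (g l x) * of_real (v x))"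
    and orth: "\<And>k l. k \<in> A \<Longrightarrow> l \<in> A \<Longrightarrow> k \<noteq> l \<Longrightarrow> (\<integral>x. g k x * cnj (g l x) * of_real (v x) \<partial>M) = 0"
  shows "(\<integral>x. (norm (\<Sum>k\<in>A. g k x))\<^sup>2 * v x \<partial>M) = (\<Sum>k\<in>A. \<integral>x. (norm (g k x))\<^sup>2 * v x \<partial>M)"
proof -
  have diag: "(\<integral>x. g k x * cnj (g k x) * of_real (v x) \<partial>M) = of_real (\<integral>x. (norm (g k x))\<^sup>2 * v x \<partial>M)" for k
    by (simp add: complex_norm_square[symmetric] flip: integral_complex_of_real of_real_power of_real_mult)
  have "complex_of_real (\<integral>x. (norm (\<Sum>k\<in>A. g k x))\<^sup>2 * v x \<partial>M)
      = (\<integral>x. of_real ((norm (\<Sum>k\<in>A. g k x))\<^sup>2 * v x) \<partial>M)"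
    by (simp only: integral_complex_of_real)
  also have "\<dots> = (\<integral>x. (\<Sum>k\<in>A. \<Sum>l\<in>A. g k x * cnj (g l x) * of_real (v x)) \<partial>M)"
    by (intro Bochner_Integration.integral_cong refl)
       (simp only: of_real_mult complex_norm_square cnj_sum sum_product, simp only: sum_distrib_right)
  also have "\<dots> = (\<Sum>k\<in>A. \<Sum>l\<in>A. \<integral>x. g k x * cnj (g l x) * of_real (v x) \<partial>M)"
    using int by (subst Bochner_Integration.integral_sum) (auto intro!: sum.cong Bochner_Integration.integral_sum)
  also have "\<dots> = (\<Sum>k\<in>A. \<Sum>l\<in>A. if l = k then of_real (\<integral>x. (norm (g k x))\<^sup>2 * v x \<partial>M) else 0)"
    using orth diag by (intro sum.cong refl) auto
  also have "\<dots> = of_real (\<Sum>k\<in>A. \<integral>x. (norm (g k x))\<^sup>2 * v x \<partial>M)"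
    using assms(1) by simp
  finally show ?thesis by (simp only: of_real_eq_iff)
qed

lemma integral_Cauchy_Schwarz:
  fixes u v :: "'x \<Rightarrow> real"
  assumes u: "integrable M (\<lambda>x. (u x)\<^sup>2)" and v: "integrable M (\<lambda>x. (v x)\<^sup>2)"
    and uv: "integrable M (\<lambda>x. u x * v x)"
  shows "(\<integral>x. u x * v x \<partial>M) \<le> sqrt (\<integral>x. (u x)\<^sup>2 \<partial>M) * sqrt (\<integral>x. (v x)\<^sup>2 \<partial>M)"
proof -
  define U V W where "U = (\<integral>x. (u x)\<^sup>2 \<partial>M)" and "V = (\<integral>x. (v x)\<^sup>2 \<partial>M)" and "W = (\<integral>x. u x * v x \<partial>M)"
  have nn: "U \<ge> 0" "V \<ge> 0" by (auto simp: U_def V_def)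
  have q: "0 \<le> s\<^sup>2 * U - 2 * s * t * W + t\<^sup>2 * V" for s t
  proof -
    have "0 \<le> (\<integral>x. (s * u x - t * v x)\<^sup>2 \<partial>M)" by simp
    also have "\<dots> = (\<integral>x. s\<^sup>2 * (u x)\<^sup>2 - 2 * s * t * (u x * v x) + t\<^sup>2 * (v x)\<^sup>2 \<partial>M)"
      by (simp add: power2_eq_square algebra_simps)
    also have "\<dots> = s\<^sup>2 * U - 2 * s * t * W + t\<^sup>2 * V"
      using u v uv by (simp add: U_def V_def W_def)
    finally show ?thesis .
  qed
  have "W\<^sup>2 \<le> U * V"
  proof (cases "V = 0")
    case True
    have "W = 0"
    proof (rule ccontr)
      assume "W \<noteq> 0"
      \<comment> \<open>For \<open>V = 0\<close> and \<open>s = 1\<close> the form is affine in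
        \<open>t\<close>, and this \<open>t\<close> gives it the value -1.\<close>
      with q[of 1 "(U + 1) / (2 * W)"] True show False by simp
    qed
    with nn show ?thesis by simp
  next
    case False
    with nn have "V > 0" by simp
    \<comment> \<open>For fixed \<open>s\<close> the form is minimal at
      \<open>t = s * W / V\<close>; taking \<open>s = V\<close> avoids the division.\<close>
    have "0 \<le> V * (V * U - W\<^sup>2)"
      using q[of V W] by (simp add: power2_eq_square algebra_simps)
    with \<open>V > 0\<close> show ?thesis by (simp add: zero_le_mult_iff mult.commute)
  qed
  hence "\<bar>W\<bar> \<le> sqrt (U * V)" by (simp add: real_le_rsqrt)
  thus ?thesis by (simp add: U_def V_def W_def real_sqrt_mult)
qed

text \<open>For frequencies on a curve, \<open>orth\<close> expresses transversality: the linear functional that vanishes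
  on the tangent direction at \<open>J = {j..<j + L}\<close> varies by \<open>O (L\<^sup>2)\<close> on \<open>J\<close>, but by at least
  a constant times \<open>(m - n) D\<close> between the frequencies with indices \<open>n\<close> and \<open>m\<close>.\<close>

locale transversal_system = finite_measure M
  for M :: "'x measure" +
  fixes e :: "nat \<Rightarrow> 'x \<Rightarrow> complex" and I :: "nat set" and C\<^sub>0 :: nat
  assumes total: "measure M (space M) = 1"
    and fin: "finite I"
    and C\<^sub>0_pos: "C\<^sub>0 \<ge> 1"
    and meas [measurable]: "\<And>n. e n \<in> borel_measurable M"
    and unimodular: "\<And>n x. norm (e n x) = 1"
    and orth: "\<And>a j L D n m. \<lbrakk>n \<in> I; m \<in> I; n < m; L \<ge> 1; D \<ge> 1; m + D \<le> j \<or> j + L + D \<le> n;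
      C\<^sub>0 * L\<^sup>2 \<le> (m - n) * D\<rbrakk> \<Longrightarrow>
      (\<integral>x. e n x * cnj (e m x) * of_real ((norm (\<Sum>k\<in>{j..<j+L} \<inter> I. a k * e k x)) ^ 4) \<partial>M) = 0"
begin

text \<open>Intersecting with \<open>I\<close> lets an interval run past the index set, so that
  lengths can be chosen as convenient products such as \<open>R * D\<close>.\<close>

definition F :: "(nat \<Rightarrow> complex) \<Rightarrow> nat set \<Rightarrow> 'x \<Rightarrow> complex" where
  "F a S x = (\<Sum>n\<in>S \<inter> I. a n * e n x)"

definition mass :: "(nat \<Rightarrow> complex) \<Rightarrow> nat set \<Rightarrow> real" where
  "mass a S = (\<Sum>n\<in>S \<inter> I. (norm (a n))\<^sup>2)"

lemma F_measurable [measurable]: "F a S \<in> borel_measurable M"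
  unfolding F_def by measurable

lemma norm_F_le: "norm (F a S x) \<le> (\<Sum>n\<in>S \<inter> I. norm (a n))"
  unfolding F_def by (rule order.trans[OF norm_sum]) (simp add: norm_mult unimodular)

lemma mass_nonneg [simp]: "mass a S \<ge> 0"
  unfolding mass_def by (simp add: sum_nonneg)

lemma integrable_prod [intro, simp]:
  "integrable M (\<lambda>x. norm (F a S x) ^ j * norm (F b T x) ^ k)"
proof (rule bounded_measurable_integrable)
  show "norm (norm (F a S x) ^ j * norm (F b T x) ^ k)
    \<le> (\<Sum>n\<in>S \<inter> I. norm (a n)) ^ j * (\<Sum>n\<in>T \<inter> I. norm (b n)) ^ k" for x
    by (auto simp: abs_mult intro!: mult_mono power_mono norm_F_le zero_le_power sum_nonneg)
qed (auto simp: finite_measure_axioms)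

lemma integrable_norm_power [intro, simp]: "integrable M (\<lambda>x. norm (F a S x) ^ k)"
  using integrable_prod[of a S k a S 0] by simp

lemma integrable_correlation:
  "integrable M (\<lambda>x. F a S x * cnj (F b T x) * of_real (norm (F c V x) ^ k))"
proof (rule bounded_measurable_integrable)
  show "norm (F a S x * cnj (F b T x) * of_real (norm (F c V x) ^ k))
    \<le> (\<Sum>n\<in>S \<inter> I. norm (a n)) * (\<Sum>n\<in>T \<inter> I. norm (b n)) * (\<Sum>n\<in>V \<inter> I. norm (c n)) ^ k" for x
    by (auto simp: norm_mult norm_power intro!: mult_mono power_mono norm_F_le mult_nonneg_nonneg sum_nonneg)
qed (auto simp: finite_measure_axioms)

lemma F_UN:
  assumes "finite A" "disjoint_family_on B A"
  shows "F a (\<Union>k\<in>A. B k) x = (\<Sum>k\<in>A. F a (B k) x)"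
proof -
  have "F a (\<Union>k\<in>A. B k) x = (\<Sum>n\<in>(\<Union>k\<in>A. B k \<inter> I). a n * e n x)"
    unfolding F_def by (intro sum.cong) auto
  also have "\<dots> = (\<Sum>k\<in>A. F a (B k) x)" unfolding F_def
    using assms fin by (intro sum.UNION_disjoint) (auto simp: disjoint_family_on_def)
  finally show ?thesis .
qed

lemma mass_UN:
  assumes "finite A" "disjoint_family_on B A"
  shows "mass a (\<Union>k\<in>A. B k) = (\<Sum>k\<in>A. mass a (B k))"
proof -
  have "mass a (\<Union>k\<in>A. B k) = (\<Sum>n\<in>(\<Union>k\<in>A. B k \<inter> I). (norm (a n))\<^sup>2)"
    unfolding mass_def by (intro sum.cong) auto
  also have "\<dots> = (\<Sum>k\<in>A. mass a (B k))" unfolding mass_def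
    using assms fin by (intro sum.UNION_disjoint) (auto simp: disjoint_family_on_def)
  finally show ?thesis .
qed

section \<open>Partition of intervals into consecutive blocks\<close>

definition block :: "nat \<Rightarrow> nat \<Rightarrow> nat \<Rightarrow> nat set" where
  "block i w k = {i + k * w..<i + k * w + w}"

lemma mem_block_iff: 
  assumes "w > 0" shows "n \<in> block i w k \<longleftrightarrow> i \<le> n \<and> (n - i) div w = k"
proof -
  have "n \<in> block i w k \<longleftrightarrow> i \<le> n \<and> k * w \<le> n - i \<and> n - i < Suc k * w"
    by (auto simp: block_def)
  also have "\<dots> \<longleftrightarrow> i \<le> n \<and> (n - i) div w = k"
    using assms by (metis div_nat_eqI dividend_less_times_div div_times_less_eq_dividend mult.commute mult_Suc)
  finally show ?thesis .
qed

lemma disjoint_blocks: "disjoint_family_on (block i w) A"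
  by (cases "w = 0") (auto simp: disjoint_family_on_def mem_block_iff, auto simp: block_def)

lemma UN_blocks: "(\<Union>k<K. block i w k) = {i..<i + K * w}"
proof (cases "w = 0")
  case False
  show ?thesis
  proof (intro set_eqI)
    fix n
    have "n \<in> {i..<i + K * w} \<longleftrightarrow> i \<le> n \<and> n - i < K * w" by auto
    also have "\<dots> \<longleftrightarrow> i \<le> n \<and> (n - i) div w < K" using False by (simp add: div_less_iff_less_mult)
    finally show "n \<in> (\<Union>k<K. block i w k) \<longleftrightarrow> n \<in> {i..<i + K * w}"
      using False by (auto simp: mem_block_iff)
  qed
qed (auto simp: block_def)

lemma F_blocks: "F a {i..<i + K * w} x = (\<Sum>k<K. F a (block i w k) x)"
  using F_UN[OF _ disjoint_blocks, of "{..<K}"] by (simp add: UN_blocks)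

lemma mass_blocks: "mass a {i..<i + K * w} = (\<Sum>k<K. mass a (block i w k))"
  using mass_UN[OF _ disjoint_blocks, of "{..<K}"] by (simp add: UN_blocks)

lemma correlation_zero:
  assumes "\<And>n m. n \<in> S \<inter> I \<Longrightarrow> m \<in> T \<inter> I \<Longrightarrow>
    (\<integral>x. e n x * cnj (e m x) * of_real (norm (F c V x) ^ k) \<partial>M) = 0"
  shows "(\<integral>x. F a S x * cnj (F b T x) * of_real (norm (F c V x) ^ k) \<partial>M) = 0"
proof -
  have int: "integrable M (\<lambda>x. e n x * cnj (e m x) * of_real (norm (F c V x) ^ k))" for n m
  proof (rule bounded_measurable_integrable)
    show "norm (e n x * cnj (e m x) * of_real (norm (F c V x) ^ k)) \<le> (\<Sum>n\<in>V \<inter> I. norm (c n)) ^ k" for x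
      by (auto simp: norm_mult norm_power unimodular intro!: power_mono norm_F_le)
  qed (auto simp: finite_measure_axioms)
  have "(\<integral>x. F a S x * cnj (F b T x) * of_real (norm (F c V x) ^ k) \<partial>M)
    = (\<integral>x. (\<Sum>n\<in>S \<inter> I. \<Sum>m\<in>T \<inter> I. (a n * cnj (b m)) *
        (e n x * cnj (e m x) * of_real (norm (F c V x) ^ k))) \<partial>M)"
    unfolding F_def[of a] F_def[of b]
    by (intro Bochner_Integration.integral_cong refl)
       (simp only: cnj_sum complex_cnj_mult sum_product, simp only: sum_distrib_right, simp only: mult_ac)
  also have "\<dots> = (\<Sum>n\<in>S \<inter> I. \<Sum>m\<in>T \<inter> I. (a n * cnj (b m)) *
        (\<integral>x. e n x * cnj (e m x) * of_real (norm (F c V x) ^ k) \<partial>M))"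
    using int by (subst Bochner_Integration.integral_sum)
      (auto intro!: sum.cong Bochner_Integration.integral_sum)
  also have "\<dots> = 0" using assms by (intro sum.neutral ballI) auto
  finally show ?thesis .
qed

text \<open>\<open>orth\<close> covers \<open>n < m\<close> only. The weight is real, so conjugating
  the integral exchanges \<open>n\<close> and \<open>m\<close>. The gap enters through a common
  lower bound \<open>w\<close> because all pairs from two blocks are treated at once.\<close>

lemma orth_sym:
  assumes "n \<in> I" "m \<in> I" "n \<noteq> m" "L \<ge> 1" "D \<ge> 1"
    "(n + D \<le> j \<and> m + D \<le> j) \<or> (j + L + D \<le> n \<and> j + L + D \<le> m)"
    "n + w \<le> m \<or> m + w \<le> n" "C\<^sub>0 * L\<^sup>2 \<le> w * D"
  shows "(\<integral>x. e n x * cnj (e m x) * of_real (norm (F a {j..<j+L} x) ^ 4) \<partial>M) = 0"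
proof -
  have *: "(\<integral>x. e n x * cnj (e m x) * of_real (norm (F a {j..<j+L} x) ^ 4) \<partial>M) = 0"
    if "n \<in> I" "m \<in> I" "n < m" "m + D \<le> j \<or> j + L + D \<le> n" "n + w \<le> m" for n m
  proof -
    have "w * D \<le> (m - n) * D" using that by (intro mult_right_mono) auto
    with assms have "C\<^sub>0 * L\<^sup>2 \<le> (m - n) * D" by linarith
    thus ?thesis using orth[of n m L D j a] that assms unfolding F_def by simp
  qed
  show ?thesis
  proof (cases "n < m")
    case True
    thus ?thesis using assms by (intro *) auto
  next
    case False
    hence zero: "(\<integral>x. e m x * cnj (e n x) * of_real (norm (F a {j..<j+L} x) ^ 4) \<partial>M) = 0"
      using assms by (intro *) auto
    have "(\<integral>x. e n x * cnj (e m x) * of_real (norm (F a {j..<j+L} x) ^ 4) \<partial>M)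
      = (\<integral>x. cnj (e m x * cnj (e n x) * of_real (norm (F a {j..<j+L} x) ^ 4)) \<partial>M)"
      by (simp add: mult_ac)
    also have "\<dots> = 0" unfolding Bochner_Integration.integral_cnj zero by simp
    finally show ?thesis .
  qed
qed

text \<open>\<open>D\<close> is the gap. Admitting both orders makes the relation symmetric in the
  two intervals, which \<open>bilinear_iteration\<close> exchanges in every step.\<close>

definition separated :: "nat \<Rightarrow> nat \<Rightarrow> nat \<Rightarrow> nat \<Rightarrow> nat \<Rightarrow> bool" where
  "separated D i A j L \<longleftrightarrow> i + A + D \<le> j \<or> j + L + D \<le> i"

text \<open>Blocks of equal parity are at distance at least \<open>w\<close>, which makes them orthogonal with respect
  to the weight \<open>\<bar>f\<^sub>J\<bar>\<^sup>4\<close>.\<close>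

lemma bilinear_orthogonality:
  assumes sep: "separated D i (K * w) j L" and "w \<ge> 1" "L \<ge> 1" "D \<ge> 1" and w: "C\<^sub>0 * L\<^sup>2 \<le> w * D"
  shows "(\<integral>x. norm (F a {i..<i + K * w} x) ^ 2 * norm (F a {j..<j+L} x) ^ 4 \<partial>M)
    \<le> 2 * (\<Sum>k<K. \<integral>x. norm (F a (block i w k) x) ^ 2 * norm (F a {j..<j+L} x) ^ 4 \<partial>M)"
proof -
  define v where "v = (\<lambda>x. norm (F a {j..<j+L} x) ^ 4)"
  have sumeq: "(\<integral>x. (norm (\<Sum>k\<in>A. F a (block i w k) x))\<^sup>2 * v x \<partial>M)
     = (\<Sum>k\<in>A. \<integral>x. (norm (F a (block i w k) x))\<^sup>2 * v x \<partial>M)"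
    if A: "A \<subseteq> {..<K}" and par: "\<And>k l. k \<in> A \<Longrightarrow> l \<in> A \<Longrightarrow> k < l \<Longrightarrow> k + 2 \<le> l" for A
  proof (rule integral_norm_sum_sq_orthogonal)
    show "finite A" using A finite_subset by blast
    fix k l assume kl: "k \<in> A" "l \<in> A"
    show "integrable M (\<lambda>x. F a (block i w k) x * cnj (F a (block i w l) x) * of_real (v x))"
      unfolding v_def by (rule integrable_correlation)
    assume "k \<noteq> l"
    show "(\<integral>x. F a (block i w k) x * cnj (F a (block i w l) x) * of_real (v x) \<partial>M) = 0"
      unfolding v_def
    proof (rule correlation_zero)
      fix n m assume nm: "n \<in> block i w k \<inter> I" "m \<in> block i w l \<inter> I"
      have sub: "block i w k \<subseteq> {i..<i + K * w}" "block i w l \<subseteq> {i..<i + K * w}"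
        using kl A by (auto simp: UN_blocks[symmetric])
      have gap: "n + w < m" if "k < l" "n \<in> block i w k" "m \<in> block i w l" "k \<in> A" "l \<in> A" for k l n m
      proof -
        have "(k + 2) * w \<le> l * w" using par that by (intro mult_right_mono) auto
        thus ?thesis using that by (auto simp: block_def)
      qed
      have "n + w < m \<or> m + w < n"
        using gap[of k l n m] gap[of l k m n] kl nm \<open>k \<noteq> l\<close> by (cases "k < l") auto
      thus "(\<integral>x. e n x * cnj (e m x) * of_real (norm (F a {j..<j+L} x) ^ 4) \<partial>M) = 0"
        using nm sub sep assms by (intro orth_sym[where w = w and D = D]) (auto simp: separated_def)
    qed
  qed
  \<comment> \<open>Adjacent blocks contain neighbouring indices, so orthogonality is used only
    within each parity class; joining the two classes costs the factor 2.\<close>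
  define P Q where "P = {k\<in>{..<K}. even k}" and "Q = {k\<in>{..<K}. odd k}"
  have EO: "{..<K} = P \<union> Q" "P \<inter> Q = {}" "finite P" "finite Q" by (auto simp: P_def Q_def)
  have intg: "integrable M (\<lambda>x. (norm (\<Sum>k\<in>A. F a (block i w k) x))\<^sup>2 * v x)" if "finite A" for A
    using integrable_prod[of a "\<Union>k\<in>A. block i w k" 2 a "{j..<j+L}" 4] that
    by (simp add: F_UN disjoint_blocks v_def)
  have "(\<integral>x. norm (F a {i..<i + K * w} x) ^ 2 * v x \<partial>M)
     \<le> (\<integral>x. 2 * ((norm (\<Sum>k\<in>P. F a (block i w k) x))\<^sup>2 * v x) + 2 * ((norm (\<Sum>k\<in>Q. F a (block i w k) x))\<^sup>2 * v x) \<partial>M)"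
  proof (rule integral_mono)
    show "integrable M (\<lambda>x. norm (F a {i..<i + K * w} x) ^ 2 * v x)" unfolding v_def by (rule integrable_prod)
    show "integrable M (\<lambda>x. 2 * ((norm (\<Sum>k\<in>P. F a (block i w k) x))\<^sup>2 * v x) + 2 * ((norm (\<Sum>k\<in>Q. F a (block i w k) x))\<^sup>2 * v x))"
      using intg EO by auto
    fix x
    have "F a {i..<i + K * w} x = (\<Sum>k\<in>P. F a (block i w k) x) + (\<Sum>k\<in>Q. F a (block i w k) x)" (is "_ = ?p + ?q")
      unfolding F_blocks using EO by (simp add: sum.union_disjoint)
    moreover have "(norm (?p + ?q))\<^sup>2 \<le> 2 * (norm ?p)\<^sup>2 + 2 * (norm ?q)\<^sup>2"
    proof -
      have "(norm (?p + ?q))\<^sup>2 \<le> (norm ?p + norm ?q)\<^sup>2" by (intro power_mono norm_triangle_ineq) auto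
      also have "\<dots> \<le> 2 * (norm ?p)\<^sup>2 + 2 * (norm ?q)\<^sup>2"
        using sum_squares_bound[of "norm ?p" "norm ?q"] by (simp add: power2_sum)
      finally show ?thesis .
    qed
    ultimately have "(norm (F a {i..<i + K * w} x))\<^sup>2 * v x \<le> (2 * (norm ?p)\<^sup>2 + 2 * (norm ?q)\<^sup>2) * v x"
      by (intro mult_right_mono) (auto simp: v_def)
    thus "(norm (F a {i..<i + K * w} x))\<^sup>2 * v x \<le> 2 * ((norm ?p)\<^sup>2 * v x) + 2 * ((norm ?q)\<^sup>2 * v x)"
      by (simp add: algebra_simps)
  qed
  also have "\<dots> = 2 * (\<integral>x. (norm (\<Sum>k\<in>P. F a (block i w k) x))\<^sup>2 * v x \<partial>M)
      + 2 * (\<integral>x. (norm (\<Sum>k\<in>Q. F a (block i w k) x))\<^sup>2 * v x \<partial>M)"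
    using intg EO by simp
  also have "\<dots> = 2 * (\<Sum>k\<in>P. \<integral>x. (norm (F a (block i w k) x))\<^sup>2 * v x \<partial>M)
      + 2 * (\<Sum>k\<in>Q. \<integral>x. (norm (F a (block i w k) x))\<^sup>2 * v x \<partial>M)"
  proof -
    have "(\<And>k l. k \<in> P \<Longrightarrow> l \<in> P \<Longrightarrow> k < l \<Longrightarrow> k + 2 \<le> l)" "(\<And>k l. k \<in> Q \<Longrightarrow> l \<in> Q \<Longrightarrow> k < l \<Longrightarrow> k + 2 \<le> l)"
      by (auto simp: P_def Q_def elim!: evenE oddE)
    moreover have "P \<subseteq> {..<K}" "Q \<subseteq> {..<K}" by (auto simp: P_def Q_def)
    ultimately show ?thesis using sumeq[of P] sumeq[of Q] by simp
  qed
  also have "\<dots> = 2 * (\<Sum>k<K. \<integral>x. (norm (F a (block i w k) x))\<^sup>2 * v x \<partial>M)"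
    using EO by (simp add: sum.union_disjoint)
  finally show ?thesis by (simp add: v_def)
qed

text \<open>Cauchy--Schwarz for the splitting of \<open>|f_S|^2 |f_T|^4\<close> into
  \<open>|f_S|^2 |f_T|\<close> and \<open>|f_T|^3\<close>. The square of the first factor is the
  original product with \<open>S\<close> and \<open>T\<close> exchanged, and the square of the
  second is a sixth power, to which an \<open>L\<^sup>6\<close> bound applies.\<close>

lemma bilinear_swap:
  "(\<integral>x. norm (F a S x) ^ 2 * norm (F a T x) ^ 4 \<partial>M)
    \<le> sqrt (\<integral>x. norm (F a T x) ^ 2 * norm (F a S x) ^ 4 \<partial>M) * sqrt (\<integral>x. norm (F a T x) ^ 6 \<partial>M)"
proof -
  have "(\<integral>x. (norm (F a S x) ^ 2 * norm (F a T x)) * norm (F a T x) ^ 3 \<partial>M)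
    \<le> sqrt (\<integral>x. (norm (F a S x) ^ 2 * norm (F a T x))\<^sup>2 \<partial>M) * sqrt (\<integral>x. (norm (F a T x) ^ 3)\<^sup>2 \<partial>M)"
  proof (rule integral_Cauchy_Schwarz)
    show "integrable M (\<lambda>x. (norm (F a S x) ^ 2 * norm (F a T x))\<^sup>2)"
      using integrable_prod[of a S 4 a T 2] by (simp add: power_mult_distrib power_mult[symmetric])
    show "integrable M (\<lambda>x. (norm (F a T x) ^ 3)\<^sup>2)" by (simp add: power_mult[symmetric])
    show "integrable M (\<lambda>x. norm (F a S x) ^ 2 * norm (F a T x) * norm (F a T x) ^ 3)"
      using integrable_prod[of a S 2 a T 4] by (simp add: mult.assoc flip: power_Suc)
  qed
  moreover have "norm (F a S x) ^ 2 * norm (F a T x) * norm (F a T x) ^ 3 = norm (F a S x) ^ 2 * norm (F a T x) ^ 4" for x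
    by (simp add: eval_nat_numeral)
  moreover have "(norm (F a S x) ^ 2 * norm (F a T x))\<^sup>2 = norm (F a T x) ^ 2 * norm (F a S x) ^ 4" for x
    by (simp add: eval_nat_numeral)
  ultimately show ?thesis by (simp flip: power_mult)
qed

end

section \<open>Inequalities for finite sums of reals\<close>

lemma sum_power4_le:
  fixes g :: "nat \<Rightarrow> real"
  shows "(\<Sum>k<K. g k) ^ 4 \<le> real K ^ 3 * (\<Sum>k<K. g k ^ 4)"
proof -
  have "(\<Sum>k<K. g k) ^ 4 = ((\<Sum>k<K. g k)\<^sup>2)\<^sup>2" by simp
  also have "\<dots> \<le> (real K * (\<Sum>k<K. (g k)\<^sup>2))\<^sup>2"
    using sum_squared_le_sum_of_squares[of g "{..<K}"] by (intro power_mono) (auto simp: mult.commute)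
  also have "\<dots> = (real K)\<^sup>2 * (\<Sum>k<K. (g k)\<^sup>2)\<^sup>2" by (simp add: power_mult_distrib)
  also have "\<dots> \<le> (real K)\<^sup>2 * (real K * (\<Sum>k<K. ((g k)\<^sup>2)\<^sup>2))"
    using sum_squared_le_sum_of_squares[of "\<lambda>k. (g k)\<^sup>2" "{..<K}"] by (intro mult_left_mono) (auto simp: mult.commute)
  finally show ?thesis by (simp add: eval_nat_numeral mult_ac)
qed

lemma sum_power_le_power_sum:
  fixes g :: "'a \<Rightarrow> real"
  assumes "finite A" "\<And>k. k \<in> A \<Longrightarrow> g k \<ge> 0" "m \<ge> 1"
  shows "(\<Sum>k\<in>A. g k ^ m) \<le> (\<Sum>k\<in>A. g k) ^ m"
proof -
  obtain m' where m: "m = Suc m'" using assms(3) by (cases m) auto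
  have "(\<Sum>k\<in>A. g k ^ m) \<le> (\<Sum>k\<in>A. g k * (\<Sum>k\<in>A. g k) ^ m')"
    unfolding m power_Suc using assms by (intro sum_mono mult_left_mono power_mono member_le_sum) auto
  thus ?thesis by (simp add: m sum_distrib_right)
qed

text \<open>If no part that is not adjacent to a maximal part has size at least \<open>S / (2 R)\<close>, then these
  parts contribute at most \<open>S / 2\<close>, so the at most three remaining parts contribute at least \<open>S / 2\<close>.\<close>

lemma broad_narrow:
  fixes g :: "nat \<Rightarrow> real"
  assumes g: "\<And>k. g k \<ge> 0" and "S \<ge> 0" and S: "S \<le> (\<Sum>k<R. g k)"
  shows "S ^ 6 \<le> 6 ^ 6 * (\<Sum>k<R. g k ^ 6)
    + (2 * real R) ^ 6 * (\<Sum>k<R. \<Sum>l | l < R \<and> (k + 2 \<le> l \<or> l + 2 \<le> k). g l ^ 2 * g k ^ 4)"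
proof (cases "R = 0")
  case True
  with assms show ?thesis by simp
next
  case False
  hence "Max (g ` {..<R}) \<in> g ` {..<R}" by (intro Max_in) auto
  then obtain k where k: "k < R" "g k = Max (g ` {..<R})" by auto
  have mx: "g l \<le> g k" if "l < R" for l unfolding k(2) using that by (intro Max_ge) auto
  define far where "far = {l. l < R \<and> (k + 2 \<le> l \<or> l + 2 \<le> k)}"
  have fin: "finite far" by (rule finite_subset[of _ "{..<R}"]) (auto simp: far_def)
  have nn: "0 \<le> (\<Sum>k<R. g k ^ 6)" "0 \<le> (\<Sum>k<R. \<Sum>l | l < R \<and> (k + 2 \<le> l \<or> l + 2 \<le> k). g l ^ 2 * g k ^ 4)"
    using g by (auto intro!: sum_nonneg)
  show ?thesis
  proof (cases "\<exists>l\<in>far. S \<le> 2 * real R * g l")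
    case True
    then obtain l where l: "l \<in> far" "S \<le> 2 * real R * g l" by blast
    have "S ^ 6 \<le> (2 * real R * g l) ^ 6" using l \<open>S \<ge> 0\<close> by (intro power_mono)
    also have "\<dots> = (2 * real R) ^ 6 * (g l ^ 2 * g l ^ 4)" by (simp add: power_mult_distrib flip: power_add)
    also have "\<dots> \<le> (2 * real R) ^ 6 * (g l ^ 2 * g k ^ 4)"
      using mx[of l] l g by (intro mult_left_mono power_mono) (auto simp: far_def)
    also have "g l ^ 2 * g k ^ 4 \<le> (\<Sum>l\<in>far. g l ^ 2 * g k ^ 4)"
      using l fin g by (intro member_le_sum[of l far "\<lambda>l. g l ^ 2 * g k ^ 4"]) auto
    \<comment> \<open>The maximal index \<open>k\<close> depends on the values of \<open>g\<close>,
      which will vary with the point of integration. Summing over all \<open>k\<close> gives a bound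
      free of this choice.\<close>
    also have "\<dots> \<le> (\<Sum>k<R. \<Sum>l | l < R \<and> (k + 2 \<le> l \<or> l + 2 \<le> k). g l ^ 2 * g k ^ 4)"
      unfolding far_def using k(1) g
      by (intro member_le_sum[of k "{..<R}" "\<lambda>k. \<Sum>l | l < R \<and> (k + 2 \<le> l \<or> l + 2 \<le> k). g l ^ 2 * g k ^ 4"])
        (auto intro!: sum_nonneg)
    finally show ?thesis using nn by (simp add: mult_left_mono)
  next
    case False
    have sub: "{..<R} - far \<subseteq> {k - 1, k, k + 1}" by (auto simp: far_def)
    have "(\<Sum>l<R. g l) = (\<Sum>l\<in>far. g l) + (\<Sum>l\<in>{..<R} - far. g l)"
      by (subst sum.subset_diff[of far "{..<R}"]) (auto simp: far_def)
    moreover have "(\<Sum>l\<in>far. g l) \<le> (\<Sum>l\<in>far. S / (2 * real R))"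
    proof (intro sum_mono)
      fix l assume "l \<in> far"
      with False have "g l * (2 * real R) \<le> S" by (auto simp: not_le mult_ac intro: less_imp_le)
      thus "g l \<le> S / (2 * real R)" using \<open>R \<noteq> 0\<close> by (subst pos_le_divide_eq) auto
    qed
    moreover have "(\<Sum>l\<in>far. S / (2 * real R)) \<le> S / 2"
    proof -
      have "card far \<le> R" using card_mono[of "{..<R}" far] by (auto simp: far_def)
      hence "real (card far) * S \<le> real R * S" using \<open>S \<ge> 0\<close> by (intro mult_right_mono) auto
      thus ?thesis using \<open>R \<noteq> 0\<close> by (simp add: field_simps)
    qed
    moreover have "(\<Sum>l\<in>{..<R} - far. g l) \<le> (\<Sum>l\<in>{..<R} - far. g k)" by (intro sum_mono mx) auto
    moreover have "(\<Sum>l\<in>{..<R} - far. g k) \<le> 3 * g k"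
    proof -
      have "card ({..<R} - far) \<le> card {k - 1, k, k + 1}" using sub by (intro card_mono) auto
      also have "\<dots> \<le> 3" by (simp add: card_insert_if)
      finally show ?thesis using g[of k] by (simp add: mult_right_mono)
    qed
    ultimately have "S \<le> 6 * g k" using S by linarith
    hence "S ^ 6 \<le> (6 * g k) ^ 6" using \<open>S \<ge> 0\<close> by (intro power_mono)
    also have "\<dots> = 6 ^ 6 * g k ^ 6" by (simp add: power_mult_distrib)
    also have "\<dots> \<le> 6 ^ 6 * (\<Sum>k<R. g k ^ 6)"
      using k g by (intro mult_left_mono member_le_sum[of k "{..<R}" "\<lambda>k. g k ^ 6"]) auto
    finally show ?thesis using nn by (simp add: add_increasing2)
  qed
qed

section \<open>Lowering the exponent of an \<open>L\<^sup>6\<close> bound\<close>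

context transversal_system begin

text \<open>The sixth power of an \<open>L\<^sup>6\<close> inequality with loss
  \<open>L powr (\<eta> / 6)\<close>. It covers all intervals and coefficients at once because the
  induction applies it to subintervals and to truncated coefficients.\<close>

definition sextic_bound :: "real \<Rightarrow> real \<Rightarrow> bool" where
  "sextic_bound C \<eta> \<longleftrightarrow> (\<forall>a i L. L \<ge> 1 \<longrightarrow>
     (\<integral>x. norm (F a {i..<i+L} x) ^ 6 \<partial>M) \<le> C * real L powr \<eta> * mass a {i..<i+L} ^ 3)"

lemma norm_F_sq_le: 
  assumes "finite S"
  shows "(norm (F a S x))\<^sup>2 \<le> real (card S) * mass a S"
proof -
  have "(norm (F a S x))\<^sup>2 \<le> (\<Sum>n\<in>S \<inter> I. norm (a n))\<^sup>2" by (intro power_mono norm_F_le) auto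
  also have "\<dots> \<le> mass a S * real (card (S \<inter> I))"
    unfolding mass_def by (rule sum_squared_le_sum_of_squares)
  also have "\<dots> \<le> mass a S * real (card S)" using assms by (intro mult_left_mono) (auto intro!: card_mono)
  finally show ?thesis by (simp add: mult.commute)
qed

lemma integral_le_const:
  fixes c :: real
  assumes "\<And>x. g x \<le> c" "c \<ge> 0"
  shows "(\<integral>x. g x \<partial>M) \<le> c"
proof (cases "integrable M g")
  case True
  hence "(\<integral>x. g x \<partial>M) \<le> (\<integral>x. c \<partial>M)" by (intro integral_mono True integrable_const) (rule assms(1))
  thus ?thesis by (simp add: total)
\<comment> \<open>The integral of a non-integrable function is 0 by convention, hence the hypothesis
  \<open>c \<ge> 0\<close>.\<close>
qed (simp add: not_integrable_integral_eq assms)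

text \<open>Pointwise Cauchy--Schwarz on a space of total mass 1. The exponent 3 is the starting
  point of the descent.\<close>

lemma sextic_bound_trivial: "sextic_bound 1 3"
  unfolding sextic_bound_def
proof (intro allI impI integral_le_const)
  fix a i x and L :: nat assume "L \<ge> 1"
  have "norm (F a {i..<i+L} x) ^ 6 = ((norm (F a {i..<i+L} x))\<^sup>2) ^ 3" by (simp flip: power_mult)
  also have "\<dots> \<le> (real L * mass a {i..<i+L}) ^ 3"
    using norm_F_sq_le[of "{i..<i+L}" a x] by (intro power_mono) auto
  also have "\<dots> = 1 * real L powr 3 * mass a {i..<i+L} ^ 3"
    using \<open>L \<ge> 1\<close> by (simp add: power_mult_distrib)
  finally show "norm (F a {i..<i+L} x) ^ 6 \<le> 1 * real L powr 3 * mass a {i..<i+L} ^ 3" .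
qed auto

lemma sextic_bound_mono:
  assumes "sextic_bound C \<eta>" "C \<le> C'" "\<eta> \<le> \<eta>'" "C \<ge> 0"
  shows "sextic_bound C' \<eta>'"
  unfolding sextic_bound_def
proof (intro allI impI)
  fix a i and L :: nat assume L: "L \<ge> 1"
  have "(\<integral>x. norm (F a {i..<i+L} x) ^ 6 \<partial>M) \<le> C * real L powr \<eta> * mass a {i..<i+L} ^ 3"
    using assms L by (auto simp: sextic_bound_def)
  also have "\<dots> \<le> C' * real L powr \<eta>' * mass a {i..<i+L} ^ 3"
    using assms L by (intro mult_right_mono mult_mono powr_mono) auto
  finally show "(\<integral>x. norm (F a {i..<i+L} x) ^ 6 \<partial>M) \<le> C' * real L powr \<eta>' * mass a {i..<i+L} ^ 3" .
qed

text \<open>Swapping the two functions by the Cauchy--Schwarz inequality replaces the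
  length \<open>R ^ (q - 2 ^ k)\<close> of the second interval by \<open>R ^ (q - 2 ^ (k + 1))\<close>, where \<open>q = 2 ^ n\<close>.
  For \<open>k = n\<close> it is a single point.\<close>

lemma bilinear_iteration:
  fixes R n :: nat
  assumes bd: "sextic_bound C \<eta>" and C: "C \<ge> 1" and R: "R \<ge> 1"
  defines "D \<equiv> C\<^sub>0 * R ^ (2 ^ n)"
  shows "k \<le> n \<Longrightarrow> separated D i A j (R ^ (2 ^ n - 2 ^ k)) \<Longrightarrow> R ^ (2 ^ n - 2 ^ Suc k) dvd A \<Longrightarrow>
    (\<integral>x. norm (F a {i..<i + A} x) ^ 2 * norm (F a {j..<j + R ^ (2 ^ n - 2 ^ k)} x) ^ 4 \<partial>M)
    \<le> 4 * C * real R powr (\<eta> * (2 ^ n - 2 ^ k * (1 + (real n - real k) / 2)))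
       * mass a {i..<i + A} * mass a {j..<j + R ^ (2 ^ n - 2 ^ k)} ^ 2"
proof (induction k arbitrary: i A j rule: inc_induct)
  \<comment> \<open>Truncated subtraction makes \<open>2 ^ n - 2 ^ Suc n\<close> equal to 0. The
    first interval is therefore cut into single points, the second is one point, and each factor is
    bounded by its single coefficient.\<close>
  case base
  have D: "D \<ge> 1" using C\<^sub>0_pos R by (simp add: D_def)
  have A: "A * 1 = A" by simp
  have "C\<^sub>0 * 1 \<le> C\<^sub>0 * R ^ 2 ^ n" using R by (intro mult_left_mono) auto
  hence "C\<^sub>0 * 1\<^sup>2 \<le> 1 * D" by (simp add: D_def)
  with base D have "(\<integral>x. norm (F a {i..<i + A * 1} x) ^ 2 * norm (F a {j..<j+1} x) ^ 4 \<partial>M)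
    \<le> 2 * (\<Sum>k<A. \<integral>x. norm (F a (block i 1 k) x) ^ 2 * norm (F a {j..<j+1} x) ^ 4 \<partial>M)"
    by (intro bilinear_orthogonality) auto
  also have "\<dots> \<le> 2 * (\<Sum>k<A. mass a (block i 1 k) * mass a {j..<j+1} ^ 2)"
  proof (intro mult_left_mono sum_mono integral_le_const)
    fix k x
    have "norm (F a {j..<j+1} x) ^ 4 = ((norm (F a {j..<j+1} x))\<^sup>2)\<^sup>2" by simp
    also have "\<dots> \<le> (mass a {j..<j+1})\<^sup>2"
      using norm_F_sq_le[of "{j..<j+1}" a x] by (intro power_mono) auto
    finally show "norm (F a (block i 1 k) x) ^ 2 * norm (F a {j..<j+1} x) ^ 4
      \<le> mass a (block i 1 k) * mass a {j..<j+1} ^ 2"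
      using norm_F_sq_le[of "block i 1 k" a x] by (intro mult_mono) (auto simp: block_def)
  qed auto
  also have "\<dots> = 2 * mass a {i..<i+A} * mass a {j..<j+1} ^ 2"
    using mass_blocks[of a i A 1] by (simp add: sum_distrib_right)
  also have "\<dots> \<le> 4 * C * mass a {i..<i+A} * mass a {j..<j+1} ^ 2"
    using C by (intro mult_right_mono) auto
  finally show ?case using R by simp
next
  case (step k)
  define q :: nat where "q = 2 ^ n"
  \<comment> \<open>The exponent of \<open>w\<close> plus \<open>q\<close> is twice the exponent of
    \<open>L\<close>, so \<open>C\<^sub>0 * L\<^sup>2 = w * D\<close>. This is the origin of the
    exponents \<open>q - 2 ^ k\<close>: at distance \<open>D\<close>, blocks of length
    \<open>w\<close> just meet the requirement of \<open>bilinear_orthogonality\<close>.\<close>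
  define L w where "L = R ^ (q - 2 ^ k)" and "w = R ^ (q - 2 ^ Suc k)"
  define s where "s = (\<lambda>k. 2 ^ n - 2 ^ k * (1 + (real n - real k) / 2))"
  define J where "J = {j..<j+L}"
  have D: "D \<ge> 1" using C\<^sub>0_pos R by (simp add: D_def)
  have Lw: "L \<ge> 1" "w \<ge> 1" using R by (auto simp: L_def w_def)
  have kq: "2 ^ Suc k \<le> q" unfolding q_def using step by (intro power_increasing) auto
  hence "2 * (q - 2 ^ k) = q - 2 ^ Suc k + q" by simp
  hence "L\<^sup>2 = w * R ^ q" by (simp add: L_def w_def flip: power_mult power_add) (simp add: mult.commute)
  hence CLD: "C\<^sub>0 * L\<^sup>2 \<le> w * D" by (simp add: D_def q_def)
  obtain K where K: "A = K * w" using step.prems(2) unfolding w_def q_def by (metis dvd_def mult.commute)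
  have sep: "separated D i (K * w) j L" using step.prems(1) by (simp add: K L_def q_def)
  have powL: "real L powr \<eta> = real R powr (\<eta> * (2 ^ n - 2 ^ k))"
  proof -
    have "real L = real R powr (real (q - 2 ^ k))" using R by (simp add: L_def powr_realpow)
    also have "real (q - 2 ^ k) = 2 ^ n - 2 ^ k"
    proof -
      have "2 ^ k \<le> q" using kq by simp
      thus ?thesis by (subst of_nat_diff) (simp_all add: q_def)
    qed
    finally show ?thesis by (simp add: powr_powr mult.commute)
  qed
  \<comment> \<open>The square roots from \<open>bilinear_swap\<close> average the exponent of the
    exchanged integral and that of the sixth moment on \<open>J\<close>. Solving this recursion with
    \<open>s n = 0\<close> produces the exponent in the statement.\<close>
  have s: "s (Suc k) + (2 ^ n - 2 ^ k) = 2 * s k"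
    using step.hyps by (simp add: s_def field_simps of_nat_diff)
  \<comment> \<open>The constant reproduces itself: the square root of \<open>4 * C * C\<close> is
    \<open>2 * C\<close>, and \<open>bilinear_orthogonality\<close> doubles it to
    \<open>4 * C\<close>.\<close>
  have blk: "(\<integral>x. norm (F a (block i w l) x) ^ 2 * norm (F a J x) ^ 4 \<partial>M)
    \<le> 2 * C * real R powr (\<eta> * s k) * mass a (block i w l) * mass a J ^ 2" if l: "l < K" for l
  proof -
    define B where "B = block i w l"
    have B: "B = {i + l * w..<i + l * w + w}" by (simp add: B_def block_def)
    have "Suc l * w \<le> K * w" using l by (intro mult_right_mono) auto
    hence sep': "separated D j L (i + l * w) w" using sep by (auto simp: separated_def)
    \<comment> \<open>After the exchange it is \<open>J\<close> that gets cut, into blocks whose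
      length is a lower power of \<open>R\<close> than \<open>L\<close>.\<close>
    have dvd: "R ^ (2 ^ n - 2 ^ Suc (Suc k)) dvd L" unfolding L_def q_def
      by (intro le_imp_power_dvd diff_le_mono2) auto
    have IH: "(\<integral>x. norm (F a J x) ^ 2 * norm (F a B x) ^ 4 \<partial>M)
      \<le> 4 * C * real R powr (\<eta> * s (Suc k)) * mass a J * mass a B ^ 2"
      using step.IH[of j L "i + l * w"] sep' dvd by (simp add: B J_def w_def q_def s_def)
    have J6: "(\<integral>x. norm (F a J x) ^ 6 \<partial>M) \<le> C * real L powr \<eta> * mass a J ^ 3"
      using bd Lw by (simp add: sextic_bound_def J_def)
    have "(\<integral>x. norm (F a B x) ^ 2 * norm (F a J x) ^ 4 \<partial>M)
      \<le> sqrt (\<integral>x. norm (F a J x) ^ 2 * norm (F a B x) ^ 4 \<partial>M) * sqrt (\<integral>x. norm (F a J x) ^ 6 \<partial>M)"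
      by (rule bilinear_swap)
    also have "\<dots> \<le> sqrt (4 * C * real R powr (\<eta> * s (Suc k)) * mass a J * mass a B ^ 2)
        * sqrt (C * real L powr \<eta> * mass a J ^ 3)"
      using IH J6 C by (intro mult_mono real_sqrt_le_mono) (auto intro!: mult_nonneg_nonneg)
    also have "\<dots> = sqrt ((2 * C * real R powr (\<eta> * s k) * mass a B * mass a J ^ 2)\<^sup>2)"
    proof -
      have "real R powr (\<eta> * s (Suc k)) * real L powr \<eta> = (real R powr (\<eta> * s k))\<^sup>2"
        using R by (simp add: powL power2_eq_square flip: powr_add distrib_left) (simp add: s)
      hence "(4 * C * real R powr (\<eta> * s (Suc k)) * mass a J * mass a B ^ 2) * (C * real L powr \<eta> * mass a J ^ 3)
        = 4 * C * C * mass a J * mass a B ^ 2 * mass a J ^ 3 * (real R powr (\<eta> * s k))\<^sup>2"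
        by (simp only: mult_ac flip: \<open>_ = (real R powr (\<eta> * s k))\<^sup>2\<close>)
      also have "\<dots> = (2 * C * real R powr (\<eta> * s k) * mass a B * mass a J ^ 2)\<^sup>2"
        by (simp add: power_mult_distrib) (simp add: eval_nat_numeral mult_ac)
      finally show ?thesis by (simp only: flip: real_sqrt_mult)
    qed
    also have "\<dots> = 2 * C * real R powr (\<eta> * s k) * mass a B * mass a J ^ 2" using C by simp
    finally show ?thesis by (simp add: B_def)
  qed
  have "(\<integral>x. norm (F a {i..<i + K * w} x) ^ 2 * norm (F a J x) ^ 4 \<partial>M)
    \<le> 2 * (\<Sum>l<K. \<integral>x. norm (F a (block i w l) x) ^ 2 * norm (F a J x) ^ 4 \<partial>M)"
    unfolding J_def by (rule bilinear_orthogonality[OF sep Lw(2,1) D CLD])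
  also have "\<dots> \<le> 2 * (\<Sum>l<K. 2 * C * real R powr (\<eta> * s k) * mass a (block i w l) * mass a J ^ 2)"
    using blk by (intro mult_left_mono sum_mono) auto
  also have "\<dots> = 4 * C * real R powr (\<eta> * s k) * mass a {i..<i + K * w} * mass a J ^ 2"
    by (simp add: mass_blocks sum_distrib_left sum_distrib_right mult_ac)
  finally show ?case by (simp only: K J_def L_def q_def s_def)
qed

text \<open>At \<open>k = 0\<close>, \<open>bilinear_iteration\<close> admits a second interval of
  length \<open>R ^ (2 ^ n - 1)\<close>. An interval of length \<open>D\<close> consists of
  \<open>C\<^sub>0 * R\<close> such pieces, and the power mean over them costs the cube of their
  number.\<close>

lemma bilinear_bound:
  fixes R n :: nat
  assumes bd: "sextic_bound C \<eta>" and C: "C \<ge> 1" and R: "R \<ge> 1"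
  defines "D \<equiv> C\<^sub>0 * R ^ (2 ^ n)"
  assumes sep: "separated D i D j D"
  shows "(\<integral>x. norm (F a {i..<i + D} x) ^ 2 * norm (F a {j..<j + D} x) ^ 4 \<partial>M)
    \<le> real (C\<^sub>0 * R) ^ 3 * (4 * C * real R powr (\<eta> * (2 ^ n - 1 - real n / 2)))
       * mass a {i..<i + D} * mass a {j..<j + D} ^ 2"
proof -
  define L K where "L = R ^ (2 ^ n - 1)" and "K = C\<^sub>0 * R"
  define B where "B = 4 * C * real R powr (\<eta> * (2 ^ n - 1 - real n / 2))"
  have DKL: "D = K * L" by (simp add: D_def K_def L_def flip: power_Suc)
  have LD: "R ^ (2 ^ n - 2 ^ Suc 0) dvd D" unfolding D_def by (intro dvd_mult le_imp_power_dvd) auto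
  have blk: "(\<integral>x. norm (F a {i..<i + D} x) ^ 2 * norm (F a (block j L l) x) ^ 4 \<partial>M)
    \<le> B * mass a {i..<i + D} * mass a (block j L l) ^ 2" if "l < K" for l
  proof -
    have "Suc l * L \<le> K * L" using that by (intro mult_right_mono) auto
    hence "separated D i D (j + l * L) (R ^ (2 ^ n - 2 ^ 0))"
      using sep by (auto simp: separated_def L_def DKL)
    from bilinear_iteration[OF bd C R, where k = 0 and n = n, OF _ this[unfolded D_def] LD[unfolded D_def]]
    show ?thesis by (simp add: block_def L_def D_def B_def diff_diff_eq)
  qed
  have "(\<integral>x. norm (F a {i..<i + D} x) ^ 2 * norm (F a {j..<j + D} x) ^ 4 \<partial>M)
     \<le> (\<integral>x. real K ^ 3 * (\<Sum>l<K. norm (F a {i..<i + D} x) ^ 2 * norm (F a (block j L l) x) ^ 4) \<partial>M)"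
  proof (rule integral_mono)
    fix x
    have "norm (F a {j..<j + D} x) ^ 4 \<le> (\<Sum>l<K. norm (F a (block j L l) x)) ^ 4"
      unfolding DKL F_blocks by (intro power_mono norm_sum) auto
    also have "\<dots> \<le> real K ^ 3 * (\<Sum>l<K. norm (F a (block j L l) x) ^ 4)" by (rule sum_power4_le)
    finally have "norm (F a {i..<i + D} x) ^ 2 * norm (F a {j..<j + D} x) ^ 4
      \<le> norm (F a {i..<i + D} x) ^ 2 * (real K ^ 3 * (\<Sum>l<K. norm (F a (block j L l) x) ^ 4))"
      by (intro mult_left_mono) auto
    thus "norm (F a {i..<i + D} x) ^ 2 * norm (F a {j..<j + D} x) ^ 4
      \<le> real K ^ 3 * (\<Sum>l<K. norm (F a {i..<i + D} x) ^ 2 * norm (F a (block j L l) x) ^ 4)"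
      by (simp add: sum_distrib_left mult_ac)
  qed auto
  also have "\<dots> = real K ^ 3 * (\<Sum>l<K. \<integral>x. norm (F a {i..<i + D} x) ^ 2 * norm (F a (block j L l) x) ^ 4 \<partial>M)"
    by simp
  also have "\<dots> \<le> real K ^ 3 * (\<Sum>l<K. B * mass a {i..<i + D} * mass a (block j L l) ^ 2)"
    using blk by (intro mult_left_mono sum_mono) auto
  also have "\<dots> = real K ^ 3 * B * mass a {i..<i + D} * (\<Sum>l<K. mass a (block j L l) ^ 2)"
    by (simp add: sum_distrib_left mult_ac)
  also have "\<dots> \<le> real K ^ 3 * B * mass a {i..<i + D} * (\<Sum>l<K. mass a (block j L l)) ^ 2"
    using C by (intro mult_left_mono sum_power_le_power_sum) (auto simp: B_def)
  finally show ?thesis by (simp add: DKL mass_blocks B_def K_def)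
qed

text \<open>The interval consists of \<open>R\<close> blocks of length \<open>D\<close>.
  Non-adjacent blocks are at distance at least \<open>D\<close>, so \<open>bilinear_bound\<close>
  controls their products. The remaining term in \<open>broad_narrow\<close> is a sum of sixth
  moments over the shorter length \<open>D\<close>, where the given bound is applied.\<close>

lemma sextic_multiscale:
  fixes R n :: nat
  assumes bd: "sextic_bound C \<eta>" and C: "C \<ge> 1" and R: "R \<ge> 1"
  defines "D \<equiv> C\<^sub>0 * R ^ (2 ^ n)"
  shows "(\<integral>x. norm (F a {i..<i + R * D} x) ^ 6 \<partial>M)
    \<le> (6 ^ 6 * (C * real D powr \<eta>) + (2 * real R) ^ 6 *
       (real (C\<^sub>0 * R) ^ 3 * (4 * C * real R powr (\<eta> * (2 ^ n - 1 - real n / 2)))))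
       * mass a {i..<i + R * D} ^ 3"
proof -
  define B where "B = real (C\<^sub>0 * R) ^ 3 * (4 * C * real R powr (\<eta> * (2 ^ n - 1 - real n / 2)))"
  define f m where "f = (\<lambda>k x. norm (F a (block i D k) x))" and "m = (\<lambda>k. mass a (block i D k))"
  define far where "far = (\<lambda>k. {l. l < R \<and> (k + 2 \<le> l \<or> l + 2 \<le> k)})"
  have D: "D \<ge> 1" using C\<^sub>0_pos R by (simp add: D_def)
  have B: "B \<ge> 0" using C by (simp add: B_def)
  have m: "m k \<ge> 0" for k by (simp add: m_def)
  have int: "integrable M (\<lambda>x. f k x ^ 6)" "integrable M (\<lambda>x. f l x ^ 2 * f k x ^ 4)" for k l
    by (auto simp: f_def)
  have far: "(\<integral>x. f l x ^ 2 * f k x ^ 4 \<partial>M) \<le> B * m l * m k ^ 2" if "l \<in> far k" for k l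
  proof -
    have "(k + 2) * D \<le> l * D \<or> (l + 2) * D \<le> k * D"
      using that mult_le_mono1[of "k + 2" l D] mult_le_mono1[of "l + 2" k D] by (auto simp: far_def)
    hence "separated D (i + l * D) D (i + k * D) D" by (auto simp: separated_def)
    from bilinear_bound[OF bd C R this[unfolded D_def]] show ?thesis
      by (simp add: f_def m_def B_def D_def block_def)
  qed
  have near: "(\<integral>x. f k x ^ 6 \<partial>M) \<le> C * real D powr \<eta> * m k ^ 3" for k
    using bd D unfolding sextic_bound_def f_def m_def block_def by blast
  have "(\<integral>x. norm (F a {i..<i + R * D} x) ^ 6 \<partial>M) \<le> (\<integral>x. 6 ^ 6 * (\<Sum>k<R. f k x ^ 6)
    + (2 * real R) ^ 6 * (\<Sum>k<R. \<Sum>l\<in>far k. f l x ^ 2 * f k x ^ 4) \<partial>M)"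
  proof (rule integral_mono)
    show "integrable M (\<lambda>x. 6 ^ 6 * (\<Sum>k<R. f k x ^ 6)
      + (2 * real R) ^ 6 * (\<Sum>k<R. \<Sum>l\<in>far k. f l x ^ 2 * f k x ^ 4))" using int by simp
    show "norm (F a {i..<i + R * D} x) ^ 6 \<le> 6 ^ 6 * (\<Sum>k<R. f k x ^ 6)
      + (2 * real R) ^ 6 * (\<Sum>k<R. \<Sum>l\<in>far k. f l x ^ 2 * f k x ^ 4)" for x
      unfolding far_def F_blocks f_def by (intro broad_narrow norm_sum) auto
  qed auto
  also have "\<dots> = 6 ^ 6 * (\<Sum>k<R. \<integral>x. f k x ^ 6 \<partial>M)
    + (2 * real R) ^ 6 * (\<Sum>k<R. \<Sum>l\<in>far k. \<integral>x. f l x ^ 2 * f k x ^ 4 \<partial>M)"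
    using int by simp
  also have "\<dots> \<le> 6 ^ 6 * (\<Sum>k<R. C * real D powr \<eta> * m k ^ 3)
    + (2 * real R) ^ 6 * (\<Sum>k<R. \<Sum>l\<in>far k. B * m l * m k ^ 2)"
    using far near by (intro add_mono mult_left_mono sum_mono) auto
  also have "\<dots> \<le> 6 ^ 6 * (\<Sum>k<R. C * real D powr \<eta> * m k ^ 3)
    + (2 * real R) ^ 6 * (\<Sum>k<R. \<Sum>l<R. B * m l * m k ^ 2)"
    using B m by (intro add_mono mult_left_mono sum_mono sum_mono2) (auto simp: far_def)
  also have "\<dots> = 6 ^ 6 * (C * real D powr \<eta>) * (\<Sum>k<R. m k ^ 3)
    + (2 * real R) ^ 6 * B * ((\<Sum>k<R. m k) * (\<Sum>k<R. m k ^ 2))"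
    by (simp add: sum_distrib_left sum_distrib_right mult_ac)
  also have "\<dots> \<le> 6 ^ 6 * (C * real D powr \<eta>) * (\<Sum>k<R. m k) ^ 3
    + (2 * real R) ^ 6 * B * ((\<Sum>k<R. m k) * (\<Sum>k<R. m k) ^ 2)"
    using B C m by (intro add_mono mult_left_mono sum_power_le_power_sum) (auto intro!: sum_nonneg)
  also have "\<dots> = (6 ^ 6 * (C * real D powr \<eta>) + (2 * real R) ^ 6 * B) * (\<Sum>k<R. m k) ^ 3"
    by (simp only: distrib_right power3_eq_cube power2_eq_square mult.assoc)
  finally show ?thesis by (simp add: mass_blocks m_def B_def)
qed

end

text \<open>The accumulated losses of one improvement: \<open>6 ^ 6\<close> from single blocks and
  \<open>2 ^ 8\<close> from separated pairs in \<open>sextic_multiscale\<close>, the cube of the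
  transversality constant, and a power of 2 from rounding \<open>R\<close> to an integer. Nothing
  else about the system enters.\<close>

definition improvement_factor :: "nat \<Rightarrow> nat \<Rightarrow> real" where
  "improvement_factor c n = (6 ^ 6 + 2 ^ 8) * real c ^ 3 * 2 ^ (3 * (2 ^ n + 1))"

context transversal_system begin

lemma improvement_factor_ge_1: "improvement_factor C\<^sub>0 n \<ge> 1"
proof -
  have "1 * 1 * 1 \<le> (6 ^ 6 + 2 ^ 8) * real C\<^sub>0 ^ 3 * 2 ^ (3 * (2 ^ n + 1))"
    using C\<^sub>0_pos by (intro mult_mono one_le_power) auto
  thus ?thesis by (simp add: improvement_factor_def)
qed

text \<open>With \<open>R\<close> near \<open>L powr (1 / (q + 1))\<close>, where
  \<open>q = 2 ^ n\<close>, the length \<open>R * D\<close> is comparable to \<open>L\<close>, and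
  the claim asks for the exponent \<open>\<delta> = (q + 1) * \<eta> - \<epsilon>\<close> of
  \<open>R\<close>. Single blocks give \<open>q * \<eta>\<close>, which is small enough by
  \<open>\<epsilon> \<le> \<eta>\<close>. Separated pairs give
  \<open>9 + \<eta> * (q - 1 - n / 2)\<close>, and here \<open>\<epsilon> * n \<ge> 18\<close> pays
  for the 9.\<close>

lemma sextic_bound_improve:
  assumes bd: "sextic_bound C \<eta>" and C: "C \<ge> 1"
    and \<epsilon>: "\<epsilon> > 0" "\<epsilon> * real n \<ge> 18" and \<eta>: "\<epsilon> \<le> \<eta>" "\<eta> \<le> 3"
  shows "sextic_bound (C * improvement_factor C\<^sub>0 n) (\<eta> - \<epsilon> / (2 ^ n + 1))"
  unfolding sextic_bound_def
proof (intro allI impI)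
  fix a :: "nat \<Rightarrow> complex" and i L :: nat assume L: "L \<ge> 1"
  define q :: nat where "q = 2 ^ n"
  define t where "t = real L powr (1 / (q + 1))"
  define R where "R = nat \<lceil>t\<rceil>"
  define D where "D = C\<^sub>0 * R ^ (2 ^ n)"
  define \<delta> where "\<delta> = (q + 1) * \<eta> - \<epsilon>"
  have t: "t \<ge> 1" unfolding t_def using L by (intro ge_one_powr_ge_zero) auto
  have R: "t \<le> real R" "real R \<le> 2 * t" "R \<ge> 1" using t by (auto simp: R_def) linarith+
  have tq: "t ^ (q + 1) = real L"
    using L by (simp add: t_def powr_powr add.commute del: power_Suc flip: powr_realpow powr_add)
  have "real L \<le> real R ^ (q + 1)" unfolding tq[symmetric] using R t by (intro power_mono) auto
  also have "\<dots> \<le> real C\<^sub>0 * real R ^ (q + 1)" using C\<^sub>0_pos mult_right_mono[of 1 "real C\<^sub>0" "real R ^ (q + 1)"] by simp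
  also have "\<dots> = real (R * D)" by (simp add: D_def q_def)
  finally have LRD: "L \<le> R * D" by linarith
  have q: "q \<ge> 1" by (simp add: q_def)
  have "\<epsilon> \<le> (q + 1) * \<eta> - real q * \<eta>" using \<eta> by (simp add: algebra_simps)
  hence \<delta>1: "real q * \<eta> \<le> \<delta>" by (simp add: \<delta>_def)
  \<comment> \<open>The 9 adds the sixth power of \<open>R\<close> lost in
    \<open>broad_narrow\<close> and the cube lost in \<open>bilinear_bound\<close>.\<close>
  have "9 + \<epsilon> \<le> 2 * \<eta> + \<eta> * (real n / 2)"
  proof -
    have "\<epsilon> * real n \<le> \<eta> * real n" using \<eta> by (intro mult_right_mono) auto
    thus ?thesis using \<epsilon> \<eta> by simp
  qed
  hence \<delta>2: "9 + \<eta> * (2 ^ n - 1 - real n / 2) \<le> \<delta>" by (simp add: \<delta>_def q_def algebra_simps)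
  have \<delta>0: "\<delta> \<ge> 0" using \<delta>1 \<eta> \<epsilon> by (smt (verit) mult_nonneg_nonneg of_nat_0_le_iff)
  \<comment> \<open>Since \<open>R * D\<close> may exceed \<open>L\<close>, the coefficients outside
    the given interval are set to 0.\<close>
  define a' where "a' = (\<lambda>k. if k \<in> {i..<i+L} then a k else 0)"
  have Fa': "F a' {i..<i + R * D} x = F a {i..<i+L} x" for x
    unfolding F_def a'_def using LRD fin by (intro sum.mono_neutral_cong_right) auto
  have ma': "mass a' {i..<i + R * D} = mass a {i..<i+L}"
    unfolding mass_def a'_def using LRD fin by (intro sum.mono_neutral_cong_right) auto
  have "(\<integral>x. norm (F a {i..<i+L} x) ^ 6 \<partial>M)
    \<le> (6 ^ 6 * (C * real D powr \<eta>) + (2 * real R) ^ 6 *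
       (real (C\<^sub>0 * R) ^ 3 * (4 * C * real R powr (\<eta> * (2 ^ n - 1 - real n / 2)))))
       * mass a {i..<i+L} ^ 3"
    using sextic_multiscale[OF bd C R(3), of a' i n] by (simp only: Fa' ma' flip: D_def)
  also have "\<dots> \<le> (C * improvement_factor C\<^sub>0 n * real L powr (\<eta> - \<epsilon> / (2 ^ n + 1))) * mass a {i..<i+L} ^ 3"
  proof (intro mult_right_mono)
    have "real D powr \<eta> = real C\<^sub>0 powr \<eta> * real R powr (real q * \<eta>)"
      using R by (simp add: D_def q_def powr_mult powr_powr flip: powr_realpow)
    also have "\<dots> \<le> real C\<^sub>0 powr 3 * real R powr \<delta>"
      using R C\<^sub>0_pos \<eta> \<delta>1 by (intro mult_mono powr_mono) auto
    finally have 1: "real D powr \<eta> \<le> real C\<^sub>0 ^ 3 * real R powr \<delta>" using C\<^sub>0_pos by simp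
    have "(2 * real R) ^ 6 * (real (C\<^sub>0 * R) ^ 3 * (4 * C * real R powr (\<eta> * (2 ^ n - 1 - real n / 2))))
      = 2 ^ 8 * real C\<^sub>0 ^ 3 * C * (real R ^ 9 * real R powr (\<eta> * (2 ^ n - 1 - real n / 2)))"
      by (simp add: power_mult_distrib)
    also have "real R ^ 9 * real R powr (\<eta> * (2 ^ n - 1 - real n / 2)) = real R powr (9 + \<eta> * (2 ^ n - 1 - real n / 2))"
      using R by (simp add: powr_add)
    also have "2 ^ 8 * real C\<^sub>0 ^ 3 * C * \<dots> \<le> 2 ^ 8 * real C\<^sub>0 ^ 3 * C * real R powr \<delta>"
      using R \<delta>2 C by (intro mult_left_mono powr_mono) auto
    finally have 2: "(2 * real R) ^ 6 * (real (C\<^sub>0 * R) ^ 3 * (4 * C * real R powr (\<eta> * (2 ^ n - 1 - real n / 2))))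
      \<le> 2 ^ 8 * real C\<^sub>0 ^ 3 * C * real R powr \<delta>" .
    have 3: "real R powr \<delta> \<le> 2 ^ (3 * (2 ^ n + 1)) * real L powr (\<eta> - \<epsilon> / (2 ^ n + 1))"
    proof -
      have eq: "\<delta> = real (q + 1) * (\<eta> - \<epsilon> / (2 ^ n + 1))"
      proof -
        have "(2::real) ^ n + 1 \<noteq> 0" by (smt (verit) zero_less_power)
        thus ?thesis by (simp add: \<delta>_def q_def field_simps)
      qed
      have "real R powr \<delta> \<le> (2 * t) powr \<delta>" using R \<delta>0 by (intro powr_mono2) auto
      also have "\<dots> = 2 powr \<delta> * t powr \<delta>" using t by (simp add: powr_mult)
      also have "t powr \<delta> = (t ^ (q + 1)) powr (\<eta> - \<epsilon> / (2 ^ n + 1))"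
        unfolding eq using t by (simp only: powr_powr powr_realpow[symmetric])
      also have "\<dots> = real L powr (\<eta> - \<epsilon> / (2 ^ n + 1))" by (simp only: tq)
      also have "2 powr \<delta> * \<dots> \<le> 2 powr real (3 * (q + 1)) * \<dots>"
      proof (intro mult_right_mono powr_mono)
        have "real (q + 1) * \<eta> \<le> real (q + 1) * 3" using \<eta> by (intro mult_left_mono) auto
        thus "\<delta> \<le> real (3 * (q + 1))" using \<epsilon> by (simp add: \<delta>_def)
      qed auto
      also have "2 powr real (3 * (q + 1)) = 2 ^ (3 * (2 ^ n + 1))" by (subst powr_realpow) (auto simp: q_def)
      finally show ?thesis .
    qed
    have "6 ^ 6 * (C * real D powr \<eta>) + (2 * real R) ^ 6 *
       (real (C\<^sub>0 * R) ^ 3 * (4 * C * real R powr (\<eta> * (2 ^ n - 1 - real n / 2))))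
      \<le> 6 ^ 6 * (C * (real C\<^sub>0 ^ 3 * real R powr \<delta>)) + 2 ^ 8 * real C\<^sub>0 ^ 3 * C * real R powr \<delta>"
      using 1 2 C by (intro add_mono mult_left_mono) auto
    also have "\<dots> = C * ((6 ^ 6 + 2 ^ 8) * real C\<^sub>0 ^ 3) * real R powr \<delta>" by (simp add: algebra_simps)
    also have "\<dots> \<le> C * ((6 ^ 6 + 2 ^ 8) * real C\<^sub>0 ^ 3) * (2 ^ (3 * (2 ^ n + 1)) * real L powr (\<eta> - \<epsilon> / (2 ^ n + 1)))"
      using 3 C by (intro mult_left_mono) auto
    finally show "6 ^ 6 * (C * real D powr \<eta>) + (2 * real R) ^ 6 *
       (real (C\<^sub>0 * R) ^ 3 * (4 * C * real R powr (\<eta> * (2 ^ n - 1 - real n / 2))))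
      \<le> C * improvement_factor C\<^sub>0 n * real L powr (\<eta> - \<epsilon> / (2 ^ n + 1))"
      by (simp only: improvement_factor_def mult_ac)
  qed auto
  finally show "(\<integral>x. norm (F a {i..<i+L} x) ^ 6 \<partial>M)
    \<le> C * improvement_factor C\<^sub>0 n * real L powr (\<eta> - \<epsilon> / (2 ^ n + 1)) * mass a {i..<i+L} ^ 3" .
qed

text \<open>Each improvement lowers the exponent by the same amount, so finitely many of them bring
  it from 3 down to \<open>\<epsilon>\<close>; the maximum stops the descent there.\<close>

lemma sextic_bound_iterate:
  assumes "0 < \<epsilon>" "\<epsilon> \<le> 3" "\<epsilon> * real n \<ge> 18"
  shows "sextic_bound (improvement_factor C\<^sub>0 n ^ k) (max \<epsilon> (3 - real k * (\<epsilon> / (2 ^ n + 1))))"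
proof (induction k)
  case 0
  show ?case using sextic_bound_trivial assms by simp
next
  case (Suc k)
  define b where "b = \<epsilon> / (2 ^ n + 1)"
  have b: "b \<ge> 0" using assms by (simp add: b_def)
  have ge1: "improvement_factor C\<^sub>0 n ^ k \<ge> 1" for k
    using improvement_factor_ge_1 by (rule one_le_power)
  have "sextic_bound (improvement_factor C\<^sub>0 n ^ k * improvement_factor C\<^sub>0 n) (max \<epsilon> (3 - real k * b) - b)"
    unfolding b_def using Suc assms ge1 by (intro sextic_bound_improve) (auto simp: b_def)
  moreover have "max \<epsilon> (3 - real k * b) - b \<le> max \<epsilon> (3 - real (Suc k) * b)"
    using b by (auto simp: algebra_simps max_def)
  ultimately show ?case
    unfolding b_def using ge1[of "Suc k"]
    by (elim sextic_bound_mono) (auto simp: mult.commute)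
qed

end

text \<open>\<open>C\<close> is fixed before the system. This uniformity is what the application
  requires, since every dyadic block of the curve yields a system of its own.\<close>

theorem sextic_bound_subpolynomial:
  assumes "\<epsilon> > 0"
  obtains C :: real where "C \<ge> 1"
    "\<And>(M :: 'x measure) e I. transversal_system M e I c \<Longrightarrow> transversal_system.sextic_bound M e I C \<epsilon>"
proof -
  \<comment> \<open>The descent starts at the exponent 3, so larger values of
    \<open>\<epsilon>\<close> are capped.\<close>
  define \<epsilon>' where "\<epsilon>' = min \<epsilon> 3"
  have \<epsilon>': "0 < \<epsilon>'" "\<epsilon>' \<le> 3" "\<epsilon>' \<le> \<epsilon>" using assms by (auto simp: \<epsilon>'_def)
  obtain n :: nat where "18 / \<epsilon>' \<le> real n" using real_arch_simple by blast
  hence n: "\<epsilon>' * real n \<ge> 18" using \<epsilon>' by (simp add: field_simps)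
  obtain k :: nat where "3 / (\<epsilon>' / (2 ^ n + 1)) \<le> real k" using real_arch_simple by blast
  hence "3 \<le> real k * (\<epsilon>' / (2 ^ n + 1))" using \<epsilon>' by (subst (asm) pos_divide_le_eq) (auto intro!: divide_pos_pos add_pos_pos)
  hence k: "max \<epsilon>' (3 - real k * (\<epsilon>' / (2 ^ n + 1))) = \<epsilon>'" using \<epsilon>' by linarith
  define C where "C = max 1 (improvement_factor c n ^ k)"
  have "transversal_system.sextic_bound M e I C \<epsilon>" if "transversal_system M e I c" for M :: "'x measure" and e I
  proof -
    interpret transversal_system M e I c by fact
    show ?thesis
    proof (rule sextic_bound_mono)
      show "sextic_bound (improvement_factor c n ^ k) \<epsilon>'"
        using sextic_bound_iterate[OF \<epsilon>'(1,2) n, of k] by (simp only: k)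
      show "0 \<le> improvement_factor c n ^ k" using improvement_factor_ge_1[of n] by (intro zero_le_power) auto
    qed (use \<epsilon>' in \<open>auto simp: C_def\<close>)
  qed
  thus ?thesis by (intro that[of C]) (auto simp: C_def)
qed

section \<open>Exponential sums along planar curves\<close>

abbreviation square_measure :: "(real \<times> real) measure" where
  "square_measure \<equiv> restrict_space lborel unit_square"

definition character :: "real \<Rightarrow> real \<Rightarrow> real \<times> real \<Rightarrow> complex" where
  "character u v = (\<lambda>(x, t). exp (2 * of_real pi * \<i> * of_real (u * x + v * t)))"

lemma norm_character [simp]: "norm (character u v z) = 1"
  by (auto simp: character_def split: prod.split simp flip: of_real_mult of_real_add)

lemma character_add: "character (u + u') (v + v') z = character u v z * character u' v' z"
  by (auto simp: character_def split: prod.split simp flip: exp_add) (simp add: algebra_simps)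

lemma cnj_character: "cnj (character u v z) = character (- u) (- v) z"
  by (auto simp: character_def exp_cnj algebra_simps split: prod.split)

lemma continuous_on_character [continuous_intros]: "continuous_on S (character u v)"
  unfolding character_def case_prod_unfold by (auto intro!: continuous_intros)

lemma unit_square_cbox: "unit_square = cbox (0, 0) (1, 1)"
  by (simp add: unit_square_def cbox_Pair_eq)

lemma square_measure_facts:
  shows "finite_measure square_measure" and "measure square_measure (space square_measure) = 1"
    and "space square_measure = unit_square"
proof -
  have sp: "space square_measure = unit_square" by (simp add: space_restrict_space)
  have "emeasure square_measure unit_square = 1"
    by (subst emeasure_restrict_space) (auto simp: unit_square_cbox emeasure_lborel_cbox_eq Basis_prod_def)
  thus "finite_measure square_measure" "measure square_measure (space square_measure) = 1"
    by (auto intro!: finite_measureI simp: sp measure_def)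
qed (simp add: space_restrict_space)

lemma borel_measurable_square_measure:
  fixes f :: "real \<times> real \<Rightarrow> 'b::topological_space"
  assumes "continuous_on UNIV f"
  shows "f \<in> borel_measurable square_measure"
  using borel_measurable_continuous_onI[OF assms] by (intro measurable_restrict_space1) auto

lemma set_integral_unit_square: "(LINT z:unit_square|lborel. f z) = (\<integral>z. f z \<partial>square_measure)"
  for f :: "real \<times> real \<Rightarrow> 'b::{banach, second_countable_topology}"
  unfolding set_lebesgue_integral_def by (subst integral_restrict_space) (auto simp: unit_square_cbox)

lemma square_integrable_continuous:
  fixes f :: "real \<times> real \<Rightarrow> 'b::{banach, second_countable_topology}"
  assumes "continuous_on UNIV f"
  shows "integrable square_measure f"
proof -
  have "set_integrable lborel unit_square f"
    unfolding set_integrable_def unit_square_cbox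
    by (intro borel_integrable_compact compact_cbox continuous_on_subset[OF assms]) auto
  thus ?thesis unfolding set_integrable_def
    by (subst integrable_restrict_space) (auto simp: unit_square_cbox)
qed

lemma integral_exp_integer:
  assumes "p \<noteq> 0"
  shows "integral {0..1} (\<lambda>x. exp (2 * of_real pi * \<i> * of_real (of_int p * x))) = 0"
proof -
  define c where "c = 2 * of_real pi * \<i> * of_int p"
  have c: "c \<noteq> 0" using assms by (simp add: c_def)
  have "((\<lambda>x. exp (c * of_real x)) has_integral exp (c * of_real 1) / c - exp (c * of_real 0) / c) {0..1}"
  proof (rule fundamental_theorem_of_calculus)
    fix x :: real
    have "((\<lambda>z. exp (c * z) / c) has_field_derivative exp (c * of_real x)) (at (of_real x))"
      using c by (auto intro!: derivative_eq_intros)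
    from has_vector_derivative_real_field[OF this]
    show "((\<lambda>x. exp (c * of_real x) / c) has_vector_derivative exp (c * of_real x)) (at x within {0..1})" .
  qed auto
  moreover have "exp c = 1" by (simp add: c_def exp_eq_1 mult_ac)
  ultimately have "((\<lambda>x. exp (c * of_real x)) has_integral 0) {0..1}" by simp
  thus ?thesis by (simp add: c_def mult_ac integral_unique)
qed

lemma integral_character:
  assumes "p \<noteq> 0 \<or> q \<noteq> 0"
  shows "(\<integral>z. character (of_int p) (of_int q) z \<partial>square_measure) = 0"
proof -
  let ?e = "\<lambda>p x. exp (2 * of_real pi * \<i> * of_real (of_int p * x)) :: complex"
  have "set_integrable lborel unit_square (character (of_int p) (of_int q))"
    unfolding set_integrable_def unit_square_cbox
    by (intro borel_integrable_compact compact_cbox continuous_on_character)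
  hence "(\<integral>z. character (of_int p) (of_int q) z \<partial>square_measure)
    = integral (cbox (0, 0) (1, 1)) (character (of_int p) (of_int q))"
    unfolding set_integral_unit_square[symmetric]
    by (subst set_borel_integral_eq_integral) (auto simp: unit_square_cbox)
  also have "\<dots> = integral (cbox 0 1) (\<lambda>x. integral (cbox 0 1) (\<lambda>t. character (of_int p) (of_int q) (x, t)))"
    by (intro integral_prod_continuous continuous_on_character)
  also have "(\<lambda>x t. character (of_int p) (of_int q) (x, t)) = (\<lambda>x t. ?e p x * ?e q t)"
    by (auto simp: character_def fun_eq_iff simp flip: exp_add) (simp add: algebra_simps)
  also have "integral (cbox 0 1) (\<lambda>x. integral (cbox 0 1) (\<lambda>t. ?e p x * ?e q t))
    = integral {0..1} (?e p) * integral {0..1} (?e q)"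
    by simp
  also have "\<dots> = 0" using assms integral_exp_integer by auto
  finally show ?thesis .
qed

lemma norm_power4_sum_character:
  "complex_of_real (norm (\<Sum>k\<in>J. a k * character (p k) (q k) z) ^ 4)
   = (\<Sum>k1\<in>J. \<Sum>k2\<in>J. \<Sum>k3\<in>J. \<Sum>k4\<in>J. (a k1 * cnj (a k2) * (a k3 * cnj (a k4))) *
       character (p k1 - p k2 + (p k3 - p k4)) (q k1 - q k2 + (q k3 - q k4)) z)"
proof -
  let ?S = "\<Sum>k\<in>J. a k * character (p k) (q k) z"
  have sq: "complex_of_real ((norm ?S)\<^sup>2)
    = (\<Sum>k\<in>J. \<Sum>l\<in>J. (a k * cnj (a l)) * character (p k - p l) (q k - q l) z)"
    unfolding complex_norm_square cnj_sum sum_product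
    by (intro sum.cong refl)
       (simp add: cnj_character character_add[of _ "- p _" _ "- q _", simplified])
  have "complex_of_real (norm ?S ^ 4) = complex_of_real ((norm ?S)\<^sup>2) * complex_of_real ((norm ?S)\<^sup>2)"
    by (simp flip: power_add)
  also have "\<dots> = (\<Sum>k1\<in>J. \<Sum>k3\<in>J. \<Sum>k2\<in>J. \<Sum>k4\<in>J. (a k1 * cnj (a k2) * (a k3 * cnj (a k4))) *
       character (p k1 - p k2 + (p k3 - p k4)) (q k1 - q k2 + (q k3 - q k4)) z)"
    unfolding sq sum_product by (intro sum.cong refl) (simp only: character_add mult_ac)
  also have "\<dots> = (\<Sum>k1\<in>J. \<Sum>k2\<in>J. \<Sum>k3\<in>J. \<Sum>k4\<in>J. (a k1 * cnj (a k2) * (a k3 * cnj (a k4))) *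
       character (p k1 - p k2 + (p k3 - p k4)) (q k1 - q k2 + (q k3 - q k4)) z)"
    by (intro sum.cong refl sum.swap)
  finally show ?thesis .
qed

text \<open>Expanding the fourth power by \<open>norm_power4_sum_character\<close> turns the
  integral in \<open>orth\<close> into a combination of integrals of single characters. Their
  frequencies are the integer vectors in \<open>nonzero\<close>, and such an integral vanishes once
  one coordinate is nonzero.\<close>

lemma transversal_system_characters:
  fixes p q :: "nat \<Rightarrow> int"
  assumes "finite I" "c \<ge> 1"
    and nonzero: "\<And>j L D n m k1 k2 k3 k4. \<lbrakk>n \<in> I; m \<in> I; n < m; D \<ge> 1; m + D \<le> j \<or> j + L + D \<le> n;
      c * L\<^sup>2 \<le> (m - n) * D; {k1, k2, k3, k4} \<subseteq> {j..<j+L} \<inter> I\<rbrakk> \<Longrightarrow>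
      p n - p m + (p k1 - p k2 + (p k3 - p k4)) \<noteq> 0 \<or> q n - q m + (q k1 - q k2 + (q k3 - q k4)) \<noteq> 0"
  shows "transversal_system square_measure (\<lambda>n. character (of_int (p n)) (of_int (q n))) I c"
proof -
  let ?e = "\<lambda>n. character (of_int (p n)) (of_int (q n))"
  have "(\<integral>x. ?e n x * cnj (?e m x) * of_real ((norm (\<Sum>k\<in>{j..<j+L} \<inter> I. a k * ?e k x)) ^ 4) \<partial>square_measure) = 0"
    if "n \<in> I" "m \<in> I" "n < m" "L \<ge> 1" "D \<ge> 1" "m + D \<le> j \<or> j + L + D \<le> n" "c * L\<^sup>2 \<le> (m - n) * D"
    for a and j L D n m :: nat
  proof -
    define J where "J = {j..<j+L} \<inter> I"
    define f where "f = (\<lambda>k1 k2 k3 k4. character (of_int (p n - p m + (p k1 - p k2 + (p k3 - p k4))))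
      (of_int (q n - q m + (q k1 - q k2 + (q k3 - q k4)))))"
    have int: "integrable square_measure (f k1 k2 k3 k4)" for k1 k2 k3 k4
      unfolding f_def by (intro square_integrable_continuous continuous_on_character)
    have zero: "(\<integral>z. f k1 k2 k3 k4 z \<partial>square_measure) = 0" if "k1 \<in> J" "k2 \<in> J" "k3 \<in> J" "k4 \<in> J" for k1 k2 k3 k4
      unfolding f_def using nonzero[of n m D j L k1 k2 k3 k4] that \<open>n \<in> I\<close> \<open>m \<in> I\<close> \<open>n < m\<close> \<open>D \<ge> 1\<close>
        \<open>m + D \<le> j \<or> j + L + D \<le> n\<close> \<open>c * L\<^sup>2 \<le> (m - n) * D\<close>
      by (intro integral_character) (auto simp: J_def)
    have "?e n z * cnj (?e m z) * of_real ((norm (\<Sum>k\<in>J. a k * ?e k z)) ^ 4)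
      = (\<Sum>k1\<in>J. \<Sum>k2\<in>J. \<Sum>k3\<in>J. \<Sum>k4\<in>J. (a k1 * cnj (a k2) * (a k3 * cnj (a k4))) * f k1 k2 k3 k4 z)" for z
    proof -
      have "?e n z * cnj (?e m z) = character (of_int (p n - p m)) (of_int (q n - q m)) z"
        using character_add[of "of_int (p n)" "- of_int (p m)" "of_int (q n)" "- of_int (q m)" z]
        by (simp add: cnj_character)
      thus ?thesis
        unfolding norm_power4_sum_character f_def of_int_add[of "p n - p m"] of_int_add[of "q n - q m"] character_add[of "of_int (p n - p m)"]
        by (simp add: sum_distrib_left mult_ac)
    qed
    hence "(\<integral>z. ?e n z * cnj (?e m z) * of_real ((norm (\<Sum>k\<in>J. a k * ?e k z)) ^ 4) \<partial>square_measure)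
      = (\<integral>z. (\<Sum>k1\<in>J. \<Sum>k2\<in>J. \<Sum>k3\<in>J. \<Sum>k4\<in>J. (a k1 * cnj (a k2) * (a k3 * cnj (a k4))) * f k1 k2 k3 k4 z) \<partial>square_measure)"
      by simp
    also have "\<dots> = (\<Sum>k1\<in>J. \<Sum>k2\<in>J. \<Sum>k3\<in>J. \<Sum>k4\<in>J. (a k1 * cnj (a k2) * (a k3 * cnj (a k4))) *
        (\<integral>z. f k1 k2 k3 k4 z \<partial>square_measure))"
      using int by simp
    also have "\<dots> = 0" using zero by simp
    finally show ?thesis by (simp add: J_def)
  qed
  thus ?thesis using assms square_measure_facts
    by (auto simp: transversal_system_def transversal_system_axioms_def
        intro!: borel_measurable_square_measure continuous_on_character)
qed

section \<open>Transversality of the curve\<close>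

lemma powr_diff_bounds:
  fixes M s t \<kappa> :: real
  assumes "\<kappa> > 0" "M > 0" and s: "M \<le> s" "s \<le> 2 * M" and t: "M \<le> t" "t \<le> 2 * M"
  defines "H \<equiv> 2 powr \<bar>\<kappa> - 1\<bar>"
  shows "\<kappa> / H * M powr (\<kappa> - 1) * \<bar>s - t\<bar> \<le> \<bar>s powr \<kappa> - t powr \<kappa>\<bar>"
    and "\<bar>s powr \<kappa> - t powr \<kappa>\<bar> \<le> \<kappa> * H * M powr (\<kappa> - 1) * \<bar>s - t\<bar>"
proof -
  have main: "\<kappa> / H * M powr (\<kappa> - 1) * \<bar>s - t\<bar> \<le> \<bar>s powr \<kappa> - t powr \<kappa>\<bar> \<and>
      \<bar>s powr \<kappa> - t powr \<kappa>\<bar> \<le> \<kappa> * H * M powr (\<kappa> - 1) * \<bar>s - t\<bar>"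
    if st: "s < t" and s: "M \<le> s" and t: "t \<le> 2 * M" for s t
  proof -
    have "\<exists>\<xi>. s < \<xi> \<and> \<xi> < t \<and> t powr \<kappa> - s powr \<kappa> = (t - s) * (\<kappa> * \<xi> powr (\<kappa> - 1))"
      using st s \<open>M > 0\<close> by (intro MVT2 has_real_derivative_powr) auto
    then obtain \<xi> where \<xi>: "s < \<xi>" "\<xi> < t" "t powr \<kappa> - s powr \<kappa> = (t - s) * (\<kappa> * \<xi> powr (\<kappa> - 1))" by blast
    \<comment> \<open>Scaling \<xi> into \<open>[1, 2]\<close> confines
      \<open>u powr (\<kappa> - 1)\<close> between \<open>1 / H\<close> and \<open>H\<close>,
      whatever the sign of \<open>\<kappa> - 1\<close>.\<close>
    define u where "u = \<xi> / M"
    have u: "1 \<le> u" "u \<le> 2" using \<xi> s t \<open>M > 0\<close> by (auto simp: u_def field_simps)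
    have eq: "\<xi> powr (\<kappa> - 1) = M powr (\<kappa> - 1) * u powr (\<kappa> - 1)"
      using \<open>M > 0\<close> u by (simp add: u_def flip: powr_mult)
    have "u powr (\<kappa> - 1) \<le> u powr \<bar>\<kappa> - 1\<bar>" using u by (intro powr_mono) auto
    also have "\<dots> \<le> H" unfolding H_def using u by (intro powr_mono2) auto
    finally have up: "u powr (\<kappa> - 1) \<le> H" .
    have "1 / H = 2 powr (- \<bar>\<kappa> - 1\<bar>)" by (simp add: H_def powr_minus_divide)
    also have "\<dots> \<le> u powr (- \<bar>\<kappa> - 1\<bar>)" using u by (intro powr_mono2') auto
    also have "\<dots> \<le> u powr (\<kappa> - 1)" using u by (intro powr_mono) auto
    finally have lo: "1 / H \<le> u powr (\<kappa> - 1)" .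
    have abs: "\<bar>s powr \<kappa> - t powr \<kappa>\<bar> = \<kappa> * M powr (\<kappa> - 1) * \<bar>s - t\<bar> * u powr (\<kappa> - 1)"
    proof -
      have "\<bar>s powr \<kappa> - t powr \<kappa>\<bar> = \<bar>t powr \<kappa> - s powr \<kappa>\<bar>" by simp
      thus ?thesis unfolding \<xi>(3) eq using st \<open>\<kappa> > 0\<close> by (simp add: abs_mult)
    qed
    have "\<kappa> * M powr (\<kappa> - 1) * \<bar>s - t\<bar> * (1 / H) \<le> \<kappa> * M powr (\<kappa> - 1) * \<bar>s - t\<bar> * u powr (\<kappa> - 1)"
      "\<kappa> * M powr (\<kappa> - 1) * \<bar>s - t\<bar> * u powr (\<kappa> - 1) \<le> \<kappa> * M powr (\<kappa> - 1) * \<bar>s - t\<bar> * H"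
      using lo up \<open>\<kappa> > 0\<close> by (intro mult_left_mono; simp)+
    thus ?thesis unfolding abs by (simp add: mult_ac)
  qed
  consider "s < t" | "t < s" | "s = t" by linarith
  hence "\<kappa> / H * M powr (\<kappa> - 1) * \<bar>s - t\<bar> \<le> \<bar>s powr \<kappa> - t powr \<kappa>\<bar> \<and>
      \<bar>s powr \<kappa> - t powr \<kappa>\<bar> \<le> \<kappa> * H * M powr (\<kappa> - 1) * \<bar>s - t\<bar>"
    using main[of s t] main[of t s] s t by cases (auto simp: abs_minus_commute)
  thus "\<kappa> / H * M powr (\<kappa> - 1) * \<bar>s - t\<bar> \<le> \<bar>s powr \<kappa> - t powr \<kappa>\<bar>"
    and "\<bar>s powr \<kappa> - t powr \<kappa>\<bar> \<le> \<kappa> * H * M powr (\<kappa> - 1) * \<bar>s - t\<bar>" by auto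
qed

text \<open>Up to scaling, \<open>\<psi> s - \<psi> s\<^sub>0\<close> is the signed distance of the point with parameter \<open>s\<close> on the
  curve \<open>(A s powr (1 + \<mu>), B s powr (1 + \<nu>))\<close> from its tangent at \<open>s\<^sub>0\<close>.\<close>

lemma tangent_distance_bounds:
  fixes \<mu> \<nu> A B M s\<^sub>0 :: real
  assumes \<mu>\<nu>: "0 < \<mu>" "\<mu> < \<nu>" and A: "A > 0" and B: "B > 0" and M: "M > 0"
    and s\<^sub>0: "M \<le> s\<^sub>0" "s\<^sub>0 \<le> 2 * M"
  defines "H \<equiv> 2 powr \<bar>\<nu> - \<mu> - 1\<bar>"
  defines "c\<^sub>1 \<equiv> (1 + \<nu>) * (\<nu> - \<mu>) / H" and "c\<^sub>2 \<equiv> (1 + \<nu>) * 2 powr \<mu> * (\<nu> - \<mu>) * H"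
  defines "lam \<equiv> B * (1 + \<nu>) * s\<^sub>0 powr (\<nu> - \<mu>) / (A * (1 + \<mu>))"
  defines "\<psi> \<equiv> \<lambda>s. B * s powr (1 + \<nu>) - lam * (A * s powr (1 + \<mu>))"
  defines "G \<equiv> B * M powr (\<nu> - 1)"
  shows "\<lbrakk>M \<le> s; s < t; t \<le> 2 * M; d \<ge> 0; \<And>\<xi>. s < \<xi> \<Longrightarrow> \<xi> < t \<Longrightarrow> d \<le> \<bar>\<xi> - s\<^sub>0\<bar>\<rbrakk> \<Longrightarrow>
      c\<^sub>1 * G * d * (t - s) \<le> \<bar>\<psi> t - \<psi> s\<bar>"
    and "\<lbrakk>M \<le> s; s \<le> 2 * M\<rbrakk> \<Longrightarrow> \<bar>\<psi> s - \<psi> s\<^sub>0\<bar> \<le> c\<^sub>2 * G * \<bar>s - s\<^sub>0\<bar>\<^sup>2"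
proof -
  \<comment> \<open>\<open>lam\<close> is the slope of the curve at \<open>s\<^sub>0\<close>. The
    derivative of \<psi> therefore vanishes there and contains the factor
    \<open>s powr (\<nu> - \<mu>) - s\<^sub>0 powr (\<nu> - \<mu>)\<close>, to which
    \<open>powr_diff_bounds\<close> applies; \<open>G\<close> is the size of the second
    derivative.\<close>
  define \<psi>' where "\<psi>' = (\<lambda>s. B * (1 + \<nu>) * s powr \<mu> * (s powr (\<nu> - \<mu>) - s\<^sub>0 powr (\<nu> - \<mu>)))"
  have deriv: "(\<psi> has_real_derivative \<psi>' s) (at s)" if "s > 0" for s
  proof -
    have lam: "lam * A * (1 + \<mu>) = B * (1 + \<nu>) * s\<^sub>0 powr (\<nu> - \<mu>)" using A \<mu>\<nu> by (simp add: lam_def)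
    have "(\<psi> has_real_derivative B * ((1 + \<nu>) * s powr (1 + \<nu> - 1)) - lam * (A * ((1 + \<mu>) * s powr (1 + \<mu> - 1)))) (at s)"
      unfolding \<psi>_def using that by (intro DERIV_diff DERIV_cmult has_real_derivative_powr)
    also have "B * ((1 + \<nu>) * s powr (1 + \<nu> - 1)) - lam * (A * ((1 + \<mu>) * s powr (1 + \<mu> - 1)))
      = B * (1 + \<nu>) * s powr \<nu> - (lam * A * (1 + \<mu>)) * s powr \<mu>"
      by (simp add: mult_ac)
    also have "\<dots> = \<psi>' s"
      unfolding lam \<psi>'_def using powr_add[of s \<mu> "\<nu> - \<mu>"] by (simp add: algebra_simps)
    finally show ?thesis .
  qed
  have MM: "M powr \<mu> * M powr (\<nu> - \<mu> - 1) = M powr (\<nu> - 1)" by (simp flip: powr_add)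
  have H: "H > 0" by (simp add: H_def)
  have bounds: "c\<^sub>1 * G * \<bar>s - s\<^sub>0\<bar> \<le> \<bar>\<psi>' s\<bar> \<and> \<bar>\<psi>' s\<bar> \<le> c\<^sub>2 * G * \<bar>s - s\<^sub>0\<bar>" if s: "M \<le> s" "s \<le> 2 * M" for s
  proof -
    have p: "M powr \<mu> \<le> s powr \<mu>" "s powr \<mu> \<le> 2 powr \<mu> * M powr \<mu>"
      using s M \<mu>\<nu> powr_mono2[of \<mu> s "2 * M"] by (auto simp: powr_mult intro: powr_mono2)
    have abs: "\<bar>\<psi>' s\<bar> = B * (1 + \<nu>) * (s powr \<mu> * \<bar>s powr (\<nu> - \<mu>) - s\<^sub>0 powr (\<nu> - \<mu>)\<bar>)"
      using B \<mu>\<nu> by (simp add: \<psi>'_def abs_mult)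
    have k: "\<nu> - \<mu> > 0" using \<mu>\<nu> by simp
    note pd = powr_diff_bounds[OF k M s s\<^sub>0, folded H_def]
    have "c\<^sub>1 * G * \<bar>s - s\<^sub>0\<bar> = B * (1 + \<nu>) * (M powr \<mu> * ((\<nu> - \<mu>) / H * M powr (\<nu> - \<mu> - 1) * \<bar>s - s\<^sub>0\<bar>))"
      unfolding c\<^sub>1_def G_def MM[symmetric] by simp
    also have "\<dots> \<le> B * (1 + \<nu>) * (s powr \<mu> * \<bar>s powr (\<nu> - \<mu>) - s\<^sub>0 powr (\<nu> - \<mu>)\<bar>)"
      using p pd B \<mu>\<nu> H by (intro mult_left_mono mult_mono) auto
    finally have 1: "c\<^sub>1 * G * \<bar>s - s\<^sub>0\<bar> \<le> \<bar>\<psi>' s\<bar>" unfolding abs .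
    have "\<bar>\<psi>' s\<bar> \<le> B * (1 + \<nu>) * ((2 powr \<mu> * M powr \<mu>) * ((\<nu> - \<mu>) * H * M powr (\<nu> - \<mu> - 1) * \<bar>s - s\<^sub>0\<bar>))"
      unfolding abs using p pd B \<mu>\<nu> H by (intro mult_left_mono mult_mono) auto
    also have "\<dots> = c\<^sub>2 * G * \<bar>s - s\<^sub>0\<bar>" unfolding c\<^sub>2_def G_def MM[symmetric] by simp
    finally show ?thesis using 1 by simp
  qed
  have pos: "c\<^sub>1 \<ge> 0" "c\<^sub>2 \<ge> 0" "G > 0" using \<mu>\<nu> B M H by (auto simp: c\<^sub>1_def c\<^sub>2_def G_def)
  show "c\<^sub>1 * G * d * (t - s) \<le> \<bar>\<psi> t - \<psi> s\<bar>"
    if "M \<le> s" "s < t" "t \<le> 2 * M" "d \<ge> 0" "\<And>\<xi>. s < \<xi> \<Longrightarrow> \<xi> < t \<Longrightarrow> d \<le> \<bar>\<xi> - s\<^sub>0\<bar>"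
  proof -
    have "\<exists>\<xi>. s < \<xi> \<and> \<xi> < t \<and> \<psi> t - \<psi> s = (t - s) * \<psi>' \<xi>"
      using that M by (intro MVT2 deriv) auto
    then obtain \<xi> where \<xi>: "s < \<xi>" "\<xi> < t" "\<psi> t - \<psi> s = (t - s) * \<psi>' \<xi>" by blast
    have "c\<^sub>1 * G * d \<le> c\<^sub>1 * G * \<bar>\<xi> - s\<^sub>0\<bar>" using that(5)[OF \<xi>(1,2)] pos by (intro mult_left_mono) auto
    also have "\<dots> \<le> \<bar>\<psi>' \<xi>\<bar>" using bounds[of \<xi>] \<xi> that by auto
    finally have "c\<^sub>1 * G * d * (t - s) \<le> \<bar>\<psi>' \<xi>\<bar> * (t - s)" using that by (intro mult_right_mono) auto
    thus ?thesis using that by (simp add: \<xi>(3) abs_mult mult.commute)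
  qed
  show "\<bar>\<psi> s - \<psi> s\<^sub>0\<bar> \<le> c\<^sub>2 * G * \<bar>s - s\<^sub>0\<bar>\<^sup>2" if s: "M \<le> s" "s \<le> 2 * M"
  proof -
    have main: "\<bar>\<psi> v - \<psi> u\<bar> \<le> c\<^sub>2 * G * \<bar>s - s\<^sub>0\<bar>\<^sup>2"
      if "u < v" "{u, v} = {s, s\<^sub>0}" for u v
    proof -
      have uv: "M \<le> u" "v \<le> 2 * M" "\<bar>s - s\<^sub>0\<bar> = v - u" using that s s\<^sub>0 by (auto simp: doubleton_eq_iff)
      have "\<exists>\<xi>. u < \<xi> \<and> \<xi> < v \<and> \<psi> v - \<psi> u = (v - u) * \<psi>' \<xi>"
        using that uv M by (intro MVT2 deriv) auto
      then obtain \<xi> where \<xi>: "u < \<xi>" "\<xi> < v" "\<psi> v - \<psi> u = (v - u) * \<psi>' \<xi>" by blast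
      have "\<bar>\<xi> - s\<^sub>0\<bar> \<le> v - u" using \<xi> that by (auto simp: doubleton_eq_iff)
      hence "c\<^sub>2 * G * \<bar>\<xi> - s\<^sub>0\<bar> \<le> c\<^sub>2 * G * (v - u)" using pos by (intro mult_left_mono) auto
      hence "\<bar>\<psi>' \<xi>\<bar> \<le> c\<^sub>2 * G * (v - u)" using bounds[of \<xi>] \<xi> uv by auto
      hence "(v - u) * \<bar>\<psi>' \<xi>\<bar> \<le> (v - u) * (c\<^sub>2 * G * (v - u))" using that by (intro mult_left_mono) auto
      thus ?thesis using that by (simp add: \<xi>(3) uv(3) abs_mult power2_eq_square mult_ac)
    qed
    consider "s < s\<^sub>0" | "s\<^sub>0 < s" | "s = s\<^sub>0" by linarith
    thus ?thesis using main[of s s\<^sub>0] main[of s\<^sub>0 s] by cases (auto simp: abs_minus_commute insert_commute)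
  qed
qed

text \<open>If both coordinates of a frequency vanished, \<psi> would satisfy the corresponding
  relation at the six indices up to rounding. Its difference between \<open>n\<close> and
  \<open>m\<close> is at least \<open>c\<^sub>1 * G * D * (m - n)\<close>, while its variation on
  the interval is at most of order \<open>G * L\<^sup>2\<close>. The lower bounds on
  \<open>A\<close> and \<open>B\<close> give \<open>lam \<le> c\<^sub>3 * G\<close> and
  \<open>1 \<le> G\<close>, so the rounding error \<open>3 + 3 * lam\<close> is of that order as
  well, a contradiction for large \<open>c\<close>.\<close>

lemma transversal_system_curve:
  fixes \<mu> \<nu> :: real
  assumes \<mu>\<nu>: "0 < \<mu>" "\<mu> < \<nu>"
  obtains c :: nat where
    "\<And>(M::nat) A B. \<lbrakk>M \<ge> 1; A > 0; B > 0; real M powr (1 - \<mu>) \<le> A; real M powr (1 - \<nu>) \<le> B\<rbrakk> \<Longrightarrow>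
       transversal_system square_measure (\<lambda>n. character (of_int \<lfloor>A * real n powr (1 + \<mu>)\<rfloor>)
         (of_int \<lfloor>B * real n powr (1 + \<nu>)\<rfloor>)) {M..<2 * M} c"
proof -
  define H where "H = 2 powr \<bar>\<nu> - \<mu> - 1\<bar>"
  define c\<^sub>1 where "c\<^sub>1 = (1 + \<nu>) * (\<nu> - \<mu>) / H"
  define c\<^sub>2 where "c\<^sub>2 = (1 + \<nu>) * 2 powr \<mu> * (\<nu> - \<mu>) * H"
  define c\<^sub>3 where "c\<^sub>3 = (1 + \<nu>) / (1 + \<mu>) * 2 powr (\<nu> - \<mu>)"
  have pos: "c\<^sub>1 > 0" "c\<^sub>2 > 0" "c\<^sub>3 > 0" using \<mu>\<nu> by (auto simp: c\<^sub>1_def c\<^sub>2_def c\<^sub>3_def H_def)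
  \<comment> \<open>The numerator adds three deviations of \<psi> on the interval and the rounding
    errors of the second and of the first coordinate; \<open>c\<^sub>1\<close> belongs to the lower
    bound they have to contradict.\<close>
  obtain c :: nat where c: "(3 * c\<^sub>2 + 3 + 3 * c\<^sub>3) / c\<^sub>1 < real c" using reals_Archimedean2 by blast
  have "0 < (3 * c\<^sub>2 + 3 + 3 * c\<^sub>3) / c\<^sub>1" using pos by simp
  with c have c1: "c \<ge> 1" by linarith
  have cc: "3 * c\<^sub>2 + 3 + 3 * c\<^sub>3 < c\<^sub>1 * real c" using c pos by (simp add: field_simps)
  have "transversal_system square_measure (\<lambda>n. character (of_int \<lfloor>A * real n powr (1 + \<mu>)\<rfloor>)
         (of_int \<lfloor>B * real n powr (1 + \<nu>)\<rfloor>)) {M..<2 * M} c"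
    if M: "M \<ge> 1" and A: "A > 0" and B: "B > 0" and AM: "real M powr (1 - \<mu>) \<le> A" and BM: "real M powr (1 - \<nu>) \<le> B"
    for M :: nat and A B :: real
  proof (rule transversal_system_characters)
    fix j L D n m k1 k2 k3 k4 :: nat
    assume n: "n \<in> {M..<2 * M}" and m: "m \<in> {M..<2 * M}" and nm: "n < m" and D: "D \<ge> 1"
      and far: "m + D \<le> j \<or> j + L + D \<le> n" and cL: "c * L\<^sup>2 \<le> (m - n) * D"
      and ks: "{k1, k2, k3, k4} \<subseteq> {j..<j + L} \<inter> {M..<2 * M}"
    define p q where "p = (\<lambda>n::nat. \<lfloor>A * real n powr (1 + \<mu>)\<rfloor>)" and "q = (\<lambda>n::nat. \<lfloor>B * real n powr (1 + \<nu>)\<rfloor>)"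
    \<comment> \<open>With the tangent taken at \<open>k1\<close>, only \<open>k2\<close>,
      \<open>k3\<close> and \<open>k4\<close> contribute a deviation.\<close>
    define s\<^sub>0 where "s\<^sub>0 = real k1"
    define lam where "lam = B * (1 + \<nu>) * s\<^sub>0 powr (\<nu> - \<mu>) / (A * (1 + \<mu>))"
    define \<psi> where "\<psi> = (\<lambda>s. B * s powr (1 + \<nu>) - lam * (A * s powr (1 + \<mu>)))"
    define G where "G = B * real M powr (\<nu> - 1)"
    have s\<^sub>0: "real M \<le> s\<^sub>0" "s\<^sub>0 \<le> 2 * real M" and M0: "real M > 0" using ks M by (auto simp: s\<^sub>0_def)
    have td1: "c\<^sub>1 * G * d * (t - s) \<le> \<bar>\<psi> t - \<psi> s\<bar>"
      if "real M \<le> s" "s < t" "t \<le> 2 * real M" "d \<ge> 0" "\<And>\<xi>. s < \<xi> \<Longrightarrow> \<xi> < t \<Longrightarrow> d \<le> \<bar>\<xi> - s\<^sub>0\<bar>" for s t d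
      unfolding c\<^sub>1_def H_def G_def \<psi>_def lam_def
      using that by (rule tangent_distance_bounds(1)[OF \<mu>\<nu> A B M0 s\<^sub>0])
    have td2: "\<bar>\<psi> s - \<psi> s\<^sub>0\<bar> \<le> c\<^sub>2 * G * \<bar>s - s\<^sub>0\<bar>\<^sup>2" if "real M \<le> s" "s \<le> 2 * real M" for s
      unfolding c\<^sub>2_def H_def G_def \<psi>_def lam_def
      using that by (rule tangent_distance_bounds(2)[OF \<mu>\<nu> A B M0 s\<^sub>0])
    have L: "L \<ge> 1" using ks by auto
    have lam0: "lam \<ge> 0" using A B \<mu>\<nu> by (auto simp: lam_def)
    have G1: "1 \<le> G"
    proof -
      have "1 = real M powr (1 - \<nu>) * real M powr (\<nu> - 1)" using M0 by (simp flip: powr_add)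
      also have "\<dots> \<le> G" unfolding G_def using BM by (intro mult_right_mono) auto
      finally show ?thesis .
    qed
    have lamG: "lam \<le> c\<^sub>3 * G"
    proof -
      have "1 / A \<le> real M powr (\<mu> - 1)"
      proof -
        have "1 = real M powr (1 - \<mu>) * real M powr (\<mu> - 1)" using M0 by (simp flip: powr_add)
        also have "\<dots> \<le> A * real M powr (\<mu> - 1)" using AM by (intro mult_right_mono) auto
        finally show ?thesis using A by (simp add: field_simps)
      qed
      moreover have "s\<^sub>0 powr (\<nu> - \<mu>) \<le> 2 powr (\<nu> - \<mu>) * real M powr (\<nu> - \<mu>)"
        using s\<^sub>0 \<mu>\<nu> M0 by (subst powr_mult[symmetric]) (auto intro!: powr_mono2)
      ultimately have "B * (1 + \<nu>) / (1 + \<mu>) * (s\<^sub>0 powr (\<nu> - \<mu>) * (1 / A))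
        \<le> B * (1 + \<nu>) / (1 + \<mu>) * ((2 powr (\<nu> - \<mu>) * real M powr (\<nu> - \<mu>)) * real M powr (\<mu> - 1))"
        using A B \<mu>\<nu> by (intro mult_left_mono mult_mono) auto
      also have "\<dots> = c\<^sub>3 * (B * (real M powr (\<nu> - \<mu>) * real M powr (\<mu> - 1)))" by (simp add: c\<^sub>3_def)
      also have "real M powr (\<nu> - \<mu>) * real M powr (\<mu> - 1) = real M powr (\<nu> - 1)" by (simp flip: powr_add)
      finally show ?thesis by (simp add: lam_def G_def mult_ac)
    qed
    show "\<lfloor>A * real n powr (1 + \<mu>)\<rfloor> - \<lfloor>A * real m powr (1 + \<mu>)\<rfloor> +
        (\<lfloor>A * real k1 powr (1 + \<mu>)\<rfloor> - \<lfloor>A * real k2 powr (1 + \<mu>)\<rfloor> +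
         (\<lfloor>A * real k3 powr (1 + \<mu>)\<rfloor> - \<lfloor>A * real k4 powr (1 + \<mu>)\<rfloor>)) \<noteq> 0 \<or>
        \<lfloor>B * real n powr (1 + \<nu>)\<rfloor> - \<lfloor>B * real m powr (1 + \<nu>)\<rfloor> +
        (\<lfloor>B * real k1 powr (1 + \<nu>)\<rfloor> - \<lfloor>B * real k2 powr (1 + \<nu>)\<rfloor> +
         (\<lfloor>B * real k3 powr (1 + \<nu>)\<rfloor> - \<lfloor>B * real k4 powr (1 + \<nu>)\<rfloor>)) \<noteq> 0"
    proof (rule ccontr)
      assume "\<not> ?thesis"
      hence "p n - p m + (p k1 - p k2 + (p k3 - p k4)) = 0" "q n - q m + (q k1 - q k2 + (q k3 - q k4)) = 0"
        by (auto simp: p_def q_def)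
      hence pq: "real_of_int (p n) - p m + (p k1 - p k2 + (p k3 - p k4)) = 0"
        "real_of_int (q n) - q m + (q k1 - q k2 + (q k3 - q k4)) = 0"
        by linarith+
      define \<alpha> \<beta> where "\<alpha> = (\<lambda>n::nat. A * real n powr (1 + \<mu>))" and "\<beta> = (\<lambda>n::nat. B * real n powr (1 + \<nu>))"
      have fl: "real_of_int (p k) \<le> \<alpha> k" "\<alpha> k < real_of_int (p k) + 1"
        "real_of_int (q k) \<le> \<beta> k" "\<beta> k < real_of_int (q k) + 1" for k
        unfolding p_def q_def \<alpha>_def \<beta>_def by linarith+
      \<comment> \<open>Each floor loses an amount in \<open>[0, 1)\<close>, and three of the six
        losses enter with each sign.\<close>
      have "\<bar>\<alpha> n - \<alpha> m + (\<alpha> k1 - \<alpha> k2 + (\<alpha> k3 - \<alpha> k4))\<bar> \<le> 3" (is "\<bar>?\<alpha>\<bar> \<le> _")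
        using pq(1) fl(1,2)[of n] fl(1,2)[of m] fl(1,2)[of k1] fl(1,2)[of k2] fl(1,2)[of k3] fl(1,2)[of k4] by linarith
      hence a3: "\<bar>lam * ?\<alpha>\<bar> \<le> lam * 3" unfolding abs_mult using lam0 by (simp add: mult_left_mono)
      have b3: "\<bar>\<beta> n - \<beta> m + (\<beta> k1 - \<beta> k2 + (\<beta> k3 - \<beta> k4))\<bar> \<le> 3" (is "\<bar>?\<beta>\<bar> \<le> _")
        using pq(2) fl(3,4)[of n] fl(3,4)[of m] fl(3,4)[of k1] fl(3,4)[of k2] fl(3,4)[of k3] fl(3,4)[of k4] by linarith
      have \<psi>: "\<psi> (real k) = \<beta> k - lam * \<alpha> k" for k by (simp add: \<psi>_def \<alpha>_def \<beta>_def)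
      have eq: "\<psi> n - \<psi> m + (\<psi> s\<^sub>0 - \<psi> k2 + (\<psi> k3 - \<psi> k4)) = ?\<beta> - lam * ?\<alpha>"
        unfolding s\<^sub>0_def \<psi> by (simp add: algebra_simps)
      have near: "\<bar>\<psi> k - \<psi> s\<^sub>0\<bar> \<le> c\<^sub>2 * G * (real L)\<^sup>2" if "k \<in> {k1, k2, k3, k4}" for k :: nat
      proof -
        have k: "k \<in> {j..<j + L}" "k1 \<in> {j..<j + L}" "M \<le> k" "k \<le> 2 * M" using ks that by auto
        have "\<bar>\<psi> k - \<psi> s\<^sub>0\<bar> \<le> c\<^sub>2 * G * \<bar>real k - s\<^sub>0\<bar>\<^sup>2" using k by (intro td2) auto
        also have "\<dots> \<le> c\<^sub>2 * G * (real L)\<^sup>2"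
          using k pos G1 by (intro mult_left_mono power_mono) (auto simp: s\<^sub>0_def)
        finally show ?thesis .
      qed
      have "c\<^sub>1 * G * real D * (real m - real n) \<le> \<bar>\<psi> m - \<psi> n\<bar>"
      proof (rule td1)
        fix \<xi> assume \<xi>: "real n < \<xi>" "\<xi> < real m"
        have "k1 \<in> {j..<j + L}" using ks by auto
        hence "real m + real D \<le> s\<^sub>0 \<or> s\<^sub>0 + real D \<le> real n"
          using far unfolding s\<^sub>0_def of_nat_add[symmetric] of_nat_le_iff by auto
        thus "real D \<le> \<bar>\<xi> - s\<^sub>0\<bar>" using \<xi> by linarith
      qed (use n m nm in auto)
      also have "\<dots> \<le> 3 * (c\<^sub>2 * G * (real L)\<^sup>2) + 3 + lam * 3"
      proof -
        have "\<bar>\<psi> k2 - \<psi> s\<^sub>0\<bar> \<le> c\<^sub>2 * G * (real L)\<^sup>2" "\<bar>\<psi> k3 - \<psi> s\<^sub>0\<bar> \<le> c\<^sub>2 * G * (real L)\<^sup>2"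
          "\<bar>\<psi> k4 - \<psi> s\<^sub>0\<bar> \<le> c\<^sub>2 * G * (real L)\<^sup>2"
          by (rule near, simp)+
        moreover define X Y where "X = lam * ?\<alpha>" and "Y = ?\<beta>"
        ultimately show ?thesis using eq[folded X_def Y_def] a3[folded X_def] b3[folded Y_def] by linarith
      qed
      also have "\<dots> \<le> 3 * (c\<^sub>2 * G * (real L)\<^sup>2) + 3 * (G * (real L)\<^sup>2) + 3 * (c\<^sub>3 * G * (real L)\<^sup>2)"
      proof -
        have L2: "1 \<le> (real L)\<^sup>2" using L by simp
        have "1 * 1 \<le> G * (real L)\<^sup>2" using G1 L2 by (intro mult_mono) auto
        moreover have "c\<^sub>3 * G * 1 \<le> c\<^sub>3 * G * (real L)\<^sup>2" using pos G1 L2 by (intro mult_left_mono) auto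
        ultimately show ?thesis using lamG by linarith
      qed
      also have "\<dots> = (3 * c\<^sub>2 + 3 + 3 * c\<^sub>3) * (G * (real L)\<^sup>2)" by (simp add: algebra_simps)
      also have "\<dots> < c\<^sub>1 * real c * (G * (real L)\<^sup>2)"
        using cc G1 L by (intro mult_strict_right_mono) auto
      also have "\<dots> = c\<^sub>1 * G * (real c * (real L)\<^sup>2)" by simp
      also have "real c * (real L)\<^sup>2 \<le> real D * (real m - real n)"
      proof -
        have "real (c * L\<^sup>2) \<le> real ((m - n) * D)" using cL by (simp only: of_nat_le_iff)
        thus ?thesis using nm by (simp add: of_nat_diff mult.commute)
      qed
      hence "c\<^sub>1 * G * (real c * (real L)\<^sup>2) \<le> c\<^sub>1 * G * (real D * (real m - real n))"
        using pos G1 by (intro mult_left_mono) auto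
      finally show False by (simp add: mult_ac)
    qed
  qed (use c1 in auto)
  thus ?thesis by (rule that)
qed

section \<open>Norms of exponential sums\<close>

lemma weighted_power_mean:
  fixes w g :: "'a \<Rightarrow> real"
  assumes "finite A" "odd k" and w: "\<And>j. j \<in> A \<Longrightarrow> w j \<ge> 0"
  shows "(\<Sum>j\<in>A. w j * g j) ^ Suc k \<le> (\<Sum>j\<in>A. w j) ^ k * (\<Sum>j\<in>A. w j * g j ^ Suc k)"
proof -
  define W where "W = (\<Sum>j\<in>A. w j)"
  show ?thesis
  proof (cases "W = 0")
    case True
    hence "\<forall>j\<in>A. w j = 0" using assms by (simp add: W_def sum_nonneg_eq_0_iff)
    thus ?thesis by (simp del: power_Suc)
  next
    case False
    hence "A \<noteq> {}" by (auto simp: W_def)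
    have W: "W > 0" using False w by (simp add: W_def sum_nonneg order_less_le)
    have "(\<Sum>j\<in>A. (w j / W) *\<^sub>R g j) ^ Suc k \<le> (\<Sum>j\<in>A. (w j / W) * g j ^ Suc k)"
      using assms W False \<open>A \<noteq> {}\<close>
      by (intro convex_on_sum[OF _ _ convex_power_even]) (auto simp: W_def simp flip: sum_divide_distrib)
    hence "((\<Sum>j\<in>A. w j * g j) / W) ^ Suc k \<le> (\<Sum>j\<in>A. w j * g j ^ Suc k) / W"
      by (simp add: sum_divide_distrib)
    hence "(\<Sum>j\<in>A. w j * g j) ^ Suc k / W ^ Suc k * W ^ Suc k \<le> (\<Sum>j\<in>A. w j * g j ^ Suc k) / W * W ^ Suc k"
      unfolding power_divide using W by (intro mult_right_mono) auto
    thus ?thesis using W by (simp add: W_def[symmetric] mult.commute)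
  qed
qed

text \<open>Expanding \<open>exp (2 \<pi> \<i> \<delta>\<^sub>n y)\<close> into its power series separates \<open>\<delta>\<^sub>n\<close> from \<open>y\<close>, so the
  twist by a frequency perturbation \<open>\<delta>\<^sub>n\<close> only modifies the coefficients.\<close>

lemma frequency_perturbation:
  fixes e :: "nat \<Rightarrow> 'x \<Rightarrow> complex" and y :: "'x \<Rightarrow> real" and \<delta> :: "nat \<Rightarrow> real"
  assumes M: "finite_measure M" and [measurable]: "\<And>n. e n \<in> borel_measurable M" "y \<in> borel_measurable M"
    and e: "\<And>n x. norm (e n x) \<le> 1" and y: "\<And>x. x \<in> space M \<Longrightarrow> \<bar>y x\<bar> \<le> 1"
    and \<delta>: "\<And>n. \<bar>\<delta> n\<bar> \<le> 1" and "finite S" and k: "odd k"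
    and bound: "\<And>b. (\<And>n. norm (b n) \<le> norm (a n)) \<Longrightarrow> (\<integral>x. norm (\<Sum>n\<in>S. b n * e n x) ^ Suc k \<partial>M) \<le> K"
  shows "(\<integral>x. norm (\<Sum>n\<in>S. a n * (e n x * exp (2 * of_real pi * \<i> * of_real (\<delta> n * y x)))) ^ Suc k \<partial>M)
    \<le> exp (2 * pi) ^ Suc k * K"
proof -
  define W where "W = exp (2 * pi)"
  define w where "w = (\<lambda>j. (2 * pi) ^ j / fact j)"
  define z where "z = (\<lambda>n x. 2 * of_real pi * \<i> * of_real (\<delta> n * y x) :: complex)"
  \<comment> \<open>The sum of the \<open>j\<close>-th terms of the power series, without the powers
    of \<open>y\<close>. Its coefficients are dominated by those of \<open>a\<close>, which is why
    \<open>bound\<close> is assumed for every dominated \<open>b\<close>.\<close>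
  define g where "g = (\<lambda>j x. \<Sum>n\<in>S. (a n * of_real (\<delta> n) ^ j) * e n x)"
  define P where "P = (\<lambda>T x. \<Sum>n\<in>S. a n * (e n x * (\<Sum>j<T. z n x ^ j /\<^sub>R fact j)))"
  define B where "B = (\<Sum>n\<in>S. norm (a n))"
  have w0: "w j \<ge> 0" for j by (simp add: w_def)
  have wsum: "w sums W" using exp_converges[of "2 * pi"] by (simp add: w_def W_def divide_inverse mult.commute)
  have wW: "(\<Sum>j<T. w j) \<le> W" for T
    using sum_le_suminf[of w "{..<T}"] wsum w0 by (auto simp: sums_iff)
  have "0 \<le> (\<integral>x. norm (\<Sum>n\<in>S. a n * e n x) ^ Suc k \<partial>M)"
    by (intro Bochner_Integration.integral_nonneg zero_le_power norm_ge_zero)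
  also have "\<dots> \<le> K" by (rule bound) auto
  finally have K: "K \<ge> 0" .
  have z: "norm (z n x) \<le> 2 * pi" if "x \<in> space M" for n x
    using \<delta>[of n] y[OF that] mult_mono[of "\<bar>\<delta> n\<bar>" 1 "\<bar>y x\<bar>" 1] by (simp add: z_def norm_mult abs_mult)
  have gB: "norm (g j x) \<le> B" for j x
    unfolding g_def B_def
  proof (rule sum_norm_le)
    fix n
    have "norm (a n) * (\<bar>\<delta> n\<bar> ^ j * norm (e n x)) \<le> norm (a n) * (1 * 1)"
      using \<delta> e by (intro mult_left_mono mult_mono power_le_one) auto
    thus "norm (a n * of_real (\<delta> n) ^ j * e n x) \<le> norm (a n)" by (simp add: norm_mult norm_power mult.assoc)
  qed
  have [measurable]: "g j \<in> borel_measurable M" "P T \<in> borel_measurable M" for j T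
    unfolding g_def P_def z_def by measurable
  have gint: "integrable M (\<lambda>x. norm (g j x) ^ Suc k)" for j
    using gB by (intro bounded_measurable_integrable[OF M, where B = "B ^ Suc k"])
      (auto intro!: power_mono simp del: power_Suc)
  have Pg: "P T x = (\<Sum>j<T. (2 * of_real pi * \<i> * of_real (y x)) ^ j /\<^sub>R fact j * g j x)" for T x
    unfolding P_def g_def z_def sum_distrib_left
    by (subst sum.swap) (auto intro!: sum.cong simp: power_mult_distrib)
  have Pw: "norm (P T x) \<le> (\<Sum>j<T. w j * norm (g j x))" if "x \<in> space M" for T x
    unfolding Pg
  proof (rule sum_norm_le)
    fix j
    have "\<bar>y x\<bar> ^ j \<le> 1" using y[OF that] by (intro power_le_one) auto
    hence "w j * \<bar>y x\<bar> ^ j * norm (g j x) \<le> w j * 1 * norm (g j x)" 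
      using w0 by (intro mult_right_mono mult_left_mono) auto
    thus "norm ((2 * of_real pi * \<i> * of_real (y x)) ^ j /\<^sub>R fact j * g j x) \<le> w j * norm (g j x)"
      by (simp add: norm_mult norm_power power_mult_distrib w_def divide_inverse mult_ac)
  qed
  have Pint: "(\<integral>x. norm (P T x) ^ Suc k \<partial>M) \<le> W ^ Suc k * K" for T
  proof -
    have "(\<integral>x. norm (P T x) ^ Suc k \<partial>M) \<le> (\<integral>x. W ^ k * (\<Sum>j<T. w j * norm (g j x) ^ Suc k) \<partial>M)"
    proof (rule integral_mono')
      show "integrable M (\<lambda>x. W ^ k * (\<Sum>j<T. w j * norm (g j x) ^ Suc k))" using gint by auto
      fix x assume x: "x \<in> space M"
      have "norm (P T x) ^ Suc k \<le> (\<Sum>j<T. w j * norm (g j x)) ^ Suc k" using Pw[OF x] by (intro power_mono) auto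
      also have "\<dots> \<le> (\<Sum>j<T. w j) ^ k * (\<Sum>j<T. w j * norm (g j x) ^ Suc k)"
        using k w0 by (intro weighted_power_mean) auto
      also have "\<dots> \<le> W ^ k * (\<Sum>j<T. w j * norm (g j x) ^ Suc k)"
        using wW w0 by (intro mult_right_mono power_mono sum_nonneg mult_nonneg_nonneg) auto
      finally show "norm (P T x) ^ Suc k \<le> W ^ k * (\<Sum>j<T. w j * norm (g j x) ^ Suc k)" .
      show "0 \<le> W ^ k * (\<Sum>j<T. w j * norm (g j x) ^ Suc k)"
        using w0 by (auto simp: W_def intro!: mult_nonneg_nonneg sum_nonneg simp del: power_Suc)
    qed
    also have "\<dots> = W ^ k * (\<Sum>j<T. w j * (\<integral>x. norm (g j x) ^ Suc k \<partial>M))" using gint by simp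
    also have "\<dots> \<le> W ^ k * (\<Sum>j<T. w j * K)"
      unfolding g_def using w0 \<delta>
      by (intro mult_left_mono sum_mono bound)
        (auto simp: W_def norm_mult norm_power intro!: mult_left_le power_le_one)
    also have "\<dots> = W ^ k * ((\<Sum>j<T. w j) * K)" by (simp add: sum_distrib_right)
    also have "\<dots> \<le> W ^ k * (W * K)" using wW K by (intro mult_left_mono mult_right_mono) (auto simp: W_def)
    finally show ?thesis by (simp add: mult_ac)
  qed
  \<comment> \<open>The power mean was applied to truncated series, uniformly in \<open>T\<close>;
    the full exponential is reached by dominated convergence.\<close>
  have "(\<lambda>T. \<integral>x. norm (P T x) ^ Suc k \<partial>M) \<longlonglongrightarrow> (\<integral>x. norm (\<Sum>n\<in>S. a n * (e n x * exp (z n x))) ^ Suc k \<partial>M)"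
  proof (rule integral_dominated_convergence)
    show "integrable M (\<lambda>x. (W * B) ^ Suc k)" using M by (simp add: finite_measure.integrable_const)
    show "AE x in M. (\<lambda>T. norm (P T x) ^ Suc k) \<longlonglongrightarrow> norm (\<Sum>n\<in>S. a n * (e n x * exp (z n x))) ^ Suc k"
      unfolding P_def using exp_converges unfolding sums_def
      by (intro AE_I2 tendsto_intros) auto
    show "AE x in M. norm (norm (P T x) ^ Suc k) \<le> (W * B) ^ Suc k" for T
    proof (rule AE_I2)
      fix x assume x: "x \<in> space M"
      have "norm (P T x) \<le> (\<Sum>j<T. w j * B)"
        using w0 gB by (intro order.trans[OF Pw[OF x]] sum_mono mult_left_mono) auto
      also have "\<dots> \<le> W * B" unfolding sum_distrib_right[symmetric]
        using wW by (intro mult_right_mono) (auto simp: B_def sum_nonneg)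
      finally have "norm (P T x) ^ Suc k \<le> (W * B) ^ Suc k" by (intro power_mono) auto
      thus "norm (norm (P T x) ^ Suc k) \<le> (W * B) ^ Suc k" by (simp del: power_Suc)
    qed
  qed (measurable, auto simp: z_def)
  hence "(\<integral>x. norm (\<Sum>n\<in>S. a n * (e n x * exp (z n x))) ^ Suc k \<partial>M) \<le> W ^ Suc k * K"
    by (rule LIMSEQ_le_const2) (use Pint in auto)
  thus ?thesis by (simp only: z_def W_def)
qed

text \<open>A real frequency is its floor plus a fractional part below 1, and both coordinates are
  at most 1 on the square. Hence \<open>frequency_perturbation\<close> applies once in each
  variable, and each application contributes a factor \<open>exp (2 * pi) ^ Suc k\<close>.\<close>

lemma character_rounding:
  fixes \<alpha> \<beta> :: "nat \<Rightarrow> real"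
  assumes "finite S" "odd k"
    and bound: "\<And>b. (\<And>n. norm (b n) \<le> norm (a n)) \<Longrightarrow>
      (\<integral>z. norm (\<Sum>n\<in>S. b n * character (of_int \<lfloor>\<alpha> n\<rfloor>) (of_int \<lfloor>\<beta> n\<rfloor>) z) ^ Suc k \<partial>square_measure) \<le> K"
  shows "(\<integral>z. norm (\<Sum>n\<in>S. a n * character (\<alpha> n) (\<beta> n) z) ^ Suc k \<partial>square_measure)
    \<le> exp (2 * pi) ^ Suc k * (exp (2 * pi) ^ Suc k * K)"
proof -
  define e where "e = (\<lambda>n. character (of_int \<lfloor>\<alpha> n\<rfloor>) (of_int \<lfloor>\<beta> n\<rfloor>))"
  define e' where "e' = (\<lambda>n z. e n z * exp (2 * of_real pi * \<i> * of_real (frac (\<alpha> n) * fst z)))"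
  have [measurable]: "e n \<in> borel_measurable square_measure" "fst \<in> borel_measurable square_measure"
    "snd \<in> borel_measurable square_measure" for n
    unfolding e_def by (intro borel_measurable_square_measure continuous_intros)+
  have fr: "\<bar>frac (x::real)\<bar> \<le> 1" for x using frac_lt_1[of x] by (simp add: less_imp_le)
  have e'_meas: "e' n \<in> borel_measurable square_measure" for n unfolding e'_def by measurable
  have sq: "\<bar>fst z\<bar> \<le> 1" "\<bar>snd z\<bar> \<le> 1" if "z \<in> space square_measure" for z
    using that[unfolded square_measure_facts(3)] by (auto simp: unit_square_def)
  have 1: "(\<integral>z. norm (\<Sum>n\<in>S. b n * e' n z) ^ Suc k \<partial>square_measure) \<le> exp (2 * pi) ^ Suc k * K"
    if b: "\<And>n. norm (b n) \<le> norm (a n)" for b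
    unfolding e'_def
  proof (rule frequency_perturbation[OF square_measure_facts(1)])
    fix b' :: "nat \<Rightarrow> complex" assume "\<And>n. norm (b' n) \<le> norm (b n)"
    with b have "norm (b' n) \<le> norm (a n)" for n by (meson order.trans)
    thus "(\<integral>z. norm (\<Sum>n\<in>S. b' n * e n z) ^ Suc k \<partial>square_measure) \<le> K"
      unfolding e_def by (rule bound)
  qed (use assms fr sq in \<open>auto simp: e_def[symmetric]\<close>, auto simp: e_def)
  have "(\<integral>z. norm (\<Sum>n\<in>S. a n * (e' n z * exp (2 * of_real pi * \<i> * of_real (frac (\<beta> n) * snd z)))) ^ Suc k \<partial>square_measure)
    \<le> exp (2 * pi) ^ Suc k * (exp (2 * pi) ^ Suc k * K)"
    using 1 e'_meas fr sq assms(1,2)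
    by (intro frequency_perturbation[OF square_measure_facts(1)]) (auto simp: e'_def e_def norm_mult)
  also have "(\<lambda>n z. e' n z * exp (2 * of_real pi * \<i> * of_real (frac (\<beta> n) * snd z))) = (\<lambda>n. character (\<alpha> n) (\<beta> n))"
  proof (intro ext)
    fix n z
    have "exp (2 * of_real pi * \<i> * of_real (frac (\<alpha> n) * fst z)) * exp (2 * of_real pi * \<i> * of_real (frac (\<beta> n) * snd z))
      = character (frac (\<alpha> n)) (frac (\<beta> n)) z"
      by (cases z) (simp add: character_def exp_add[symmetric] algebra_simps)
    hence "e' n z * exp (2 * of_real pi * \<i> * of_real (frac (\<beta> n) * snd z)) = e n z * character (frac (\<alpha> n)) (frac (\<beta> n)) z"
      by (simp add: e'_def mult.assoc)
    thus "e' n z * exp (2 * of_real pi * \<i> * of_real (frac (\<beta> n) * snd z)) = character (\<alpha> n) (\<beta> n) z"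
      by (simp add: e_def frac_def flip: character_add)
  qed
  finally show ?thesis .
qed

text \<open>The substitution \<open>(x, t) = (A * x', B * t')\<close> pulls the square back to
  \<open>[0, 1 / A]\<close> times \<open>[0, 1 / B]\<close>, which lies in the unit square.
  Extending the domain to the whole square is allowed since \<open>f\<close> is nonnegative.\<close>

lemma square_integral_rescale:
  fixes f :: "real \<times> real \<Rightarrow> real"
  assumes cont: "continuous_on UNIV f" and nonneg: "\<And>z. f z \<ge> 0" and A: "A \<ge> 1" and B: "B \<ge> 1"
  shows "(\<integral>z. f z \<partial>square_measure) \<le> A * B * (\<integral>z. f (A * fst z, B * snd z) \<partial>square_measure)"
proof -
  define T where "T = (\<lambda>z::real \<times> real. (A * fst z, B * snd z))"
  define h where "h = (\<lambda>z. indicator unit_square z * f z)"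
  define c :: "real \<times> real \<Rightarrow> real" where "c = (\<lambda>j. if j = (1, 0) then A else B)"
  have fm: "f \<in> borel_measurable borel" using cont by (rule borel_measurable_continuous_onI)
  have hm: "h \<in> borel_measurable borel" unfolding h_def unit_square_cbox using fm by measurable
  have Tc: "continuous_on UNIV T" unfolding T_def by (intro continuous_intros)
  have Tm: "T \<in> borel_measurable borel" using Tc by (rule borel_measurable_continuous_onI)
  have Basis: "(Basis :: (real \<times> real) set) = {(1, 0), (0, 1)}" by (auto simp: Basis_prod_def)
  have "lborel = density (distr lborel borel (\<lambda>x. 0 + (\<Sum>j\<in>Basis. (c j * (x \<bullet> j)) *\<^sub>R j))) (\<lambda>_. \<Prod>j\<in>Basis. \<bar>c j\<bar>)"
    using A B by (intro lborel_affine_euclidean) (auto simp: c_def)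
  also have "(\<lambda>x. 0 + (\<Sum>j\<in>Basis. (c j * (x \<bullet> j)) *\<^sub>R j)) = T"
    by (auto simp: Basis T_def c_def fun_eq_iff)
  also have "(\<Prod>j\<in>Basis. \<bar>c j\<bar>) = A * B" using A B by (simp add: Basis c_def)
  finally have lb: "lborel = density (distr lborel borel T) (\<lambda>_. ennreal (A * B))" .
  have "(\<integral>z. f z \<partial>square_measure) = (\<integral>z. h z \<partial>lborel)"
    unfolding set_integral_unit_square[symmetric] by (simp add: set_lebesgue_integral_def h_def)
  also have "\<dots> = (\<integral>z. h z \<partial>density (distr lborel borel T) (\<lambda>_. ennreal (A * B)))"
    by (simp only: lb[symmetric])
  also have "\<dots> = A * B * (\<integral>z. h (T z) \<partial>lborel)"
    using hm Tm A B by (subst integral_real_density) (auto simp: integral_distr)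
  also have "(\<integral>z. h (T z) \<partial>lborel) \<le> (\<integral>z. indicator unit_square z * f (T z) \<partial>lborel)"
  proof (rule integral_mono')
    have "continuous_on unit_square (\<lambda>z. f (T z))"
      by (rule continuous_on_subset[OF continuous_on_compose2[OF cont Tc]]) auto
    thus "integrable lborel (\<lambda>z. indicator unit_square z * f (T z))"
      using borel_integrable_compact[of unit_square "\<lambda>z. f (T z)"] by (simp add: unit_square_cbox)
    show "h (T z) \<le> indicator unit_square z * f (T z)" for z
    proof -
      have "z \<in> unit_square" if "T z \<in> unit_square"
      proof -
        have "x \<in> {0..1}" if "c * x \<in> {0..1}" "c \<ge> 1" for c x :: real
        proof -
          have "x \<ge> 0" using that by (simp add: zero_le_mult_iff)
          moreover have "1 * x \<le> c * x" using that calculation by (intro mult_right_mono) auto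
          ultimately show ?thesis using that by auto
        qed
        from this[of A "fst z"] this[of B "snd z"] show ?thesis using that A B
          by (cases z) (simp add: T_def unit_square_def)
      qed
      thus ?thesis using nonneg by (auto simp: h_def indicator_def)
    qed
  qed (use nonneg in auto)
  also have "(\<integral>z. indicator unit_square z * f (T z) \<partial>lborel) = (\<integral>z. f (T z) \<partial>square_measure)"
    unfolding set_integral_unit_square[symmetric] by (simp add: set_lebesgue_integral_def)
  finally show ?thesis using A B by (simp add: T_def mult_left_mono)
qed

lemma exp_sum_character:
  "exp_sum \<mu> \<nu> N a z = (\<Sum>n = 1..N. a n * character (real n powr (1 + \<mu>)) (real n powr (1 + \<nu>)) z)"
  by (cases z) (simp add: exp_sum_def character_def)

section \<open>The sixth moment of the exponential sum\<close>

lemma dyadic_sextic_estimate: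
  fixes \<mu> \<nu> \<epsilon> :: real
  assumes \<mu>\<nu>: "0 < \<mu>" "\<mu> < \<nu>" and \<epsilon>: "\<epsilon> > 0"
  obtains C :: real where "C > 0" "\<And>M a. M \<ge> 1 \<Longrightarrow>
    (\<integral>z. norm (\<Sum>n\<in>{M..<2 * M}. a n * character (real n powr (1 + \<mu>)) (real n powr (1 + \<nu>)) z) ^ 6 \<partial>square_measure)
    \<le> C * real M powr (max 2 (1 + \<mu>) + max 2 (1 + \<nu>) - 2 - \<mu> - \<nu> + \<epsilon>) * (\<Sum>n\<in>{M..<2 * M}. (norm (a n))\<^sup>2) ^ 3"
proof -
  obtain c where c: "\<And>(M::nat) A B. \<lbrakk>M \<ge> 1; A > 0; B > 0; real M powr (1 - \<mu>) \<le> A; real M powr (1 - \<nu>) \<le> B\<rbrakk> \<Longrightarrow>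
       transversal_system square_measure (\<lambda>n. character (of_int \<lfloor>A * real n powr (1 + \<mu>)\<rfloor>)
         (of_int \<lfloor>B * real n powr (1 + \<nu>)\<rfloor>)) {M..<2 * M} c"
    using transversal_system_curve[OF \<mu>\<nu>] by blast
  obtain C where C: "C \<ge> 1" "\<And>(M :: (real \<times> real) measure) e I. transversal_system M e I c \<Longrightarrow>
      transversal_system.sextic_bound M e I C \<epsilon>"
    using sextic_bound_subpolynomial[OF \<epsilon>] by blast
  define W where "W = exp (2 * pi) ^ 6"
  define r\<^sub>1 r\<^sub>2 where "r\<^sub>1 = max 2 (1 + \<mu>)" and "r\<^sub>2 = max 2 (1 + \<nu>)"
  have main: "(\<integral>z. norm (\<Sum>n\<in>{M..<2 * M}. a n * character (real n powr (1 + \<mu>)) (real n powr (1 + \<nu>)) z) ^ 6 \<partial>square_measure)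
    \<le> (W * (W * C)) * real M powr (r\<^sub>1 + r\<^sub>2 - 2 - \<mu> - \<nu> + \<epsilon>) * (\<Sum>n\<in>{M..<2 * M}. (norm (a n))\<^sup>2) ^ 3"
    if M: "M \<ge> 1" for M :: nat and a :: "nat \<Rightarrow> complex"
  proof -
    \<comment> \<open>The exponent \<open>r\<^sub>1 - 1 - \<mu>\<close> is the maximum of
      \<open>1 - \<mu>\<close> and 0, so \<open>A\<close> is the least factor with
      \<open>A \<ge> 1\<close>, needed for rescaling, and \<open>A \<ge> M powr (1 - \<mu>)\<close>,
      needed for transversality; likewise for \<open>B\<close>.\<close>
    define A B where "A = real M powr (r\<^sub>1 - 1 - \<mu>)" and "B = real M powr (r\<^sub>2 - 1 - \<nu>)"
    have AB: "A \<ge> 1" "B \<ge> 1" "real M powr (1 - \<mu>) \<le> A" "real M powr (1 - \<nu>) \<le> B"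
      using M by (auto simp: A_def B_def r\<^sub>1_def r\<^sub>2_def intro!: ge_one_powr_ge_zero powr_mono)
    define \<alpha> \<beta> where "\<alpha> = (\<lambda>n. A * real n powr (1 + \<mu>))" and "\<beta> = (\<lambda>n. B * real n powr (1 + \<nu>))"
    define m where "m = (\<Sum>n\<in>{M..<2 * M}. (norm (a n))\<^sup>2)"
    define K where "K = C * real M powr \<epsilon> * m ^ 3"
    interpret ts: transversal_system square_measure "\<lambda>n. character (of_int \<lfloor>\<alpha> n\<rfloor>) (of_int \<lfloor>\<beta> n\<rfloor>)" "{M..<2 * M}" c
      unfolding \<alpha>_def \<beta>_def using M AB by (intro c) auto
    have "(\<integral>z. norm (\<Sum>n\<in>{M..<2 * M}. a n * character (\<alpha> n) (\<beta> n) z) ^ Suc 5 \<partial>square_measure)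
      \<le> exp (2 * pi) ^ Suc 5 * (exp (2 * pi) ^ Suc 5 * K)"
    proof (rule character_rounding)
      fix b :: "nat \<Rightarrow> complex" assume b: "\<And>n. norm (b n) \<le> norm (a n)"
      have "ts.sextic_bound C \<epsilon>" by (intro C ts.transversal_system_axioms)
      hence "(\<integral>x. norm (ts.F b {M..<M+M} x) ^ 6 \<partial>square_measure) \<le> C * real M powr \<epsilon> * ts.mass b {M..<M+M} ^ 3"
        using M unfolding ts.sextic_bound_def by blast
      also have "\<dots> \<le> C * real M powr \<epsilon> * m ^ 3"
        unfolding ts.mass_def m_def using C b
        by (intro mult_left_mono power_mono sum_nonneg) (auto simp: mult_2 intro!: sum_mono power_mono)
      finally show "(\<integral>z. norm (\<Sum>n\<in>{M..<2 * M}. b n * character (of_int \<lfloor>\<alpha> n\<rfloor>) (of_int \<lfloor>\<beta> n\<rfloor>) z) ^ Suc 5 \<partial>square_measure) \<le> K"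
        unfolding ts.F_def mult_2[symmetric] Int_absorb by (simp add: K_def)
    qed auto
    hence rounded: "(\<integral>z. norm (\<Sum>n\<in>{M..<2 * M}. a n * character (\<alpha> n) (\<beta> n) z) ^ 6 \<partial>square_measure) \<le> W * (W * K)"
      by (simp add: W_def)
    have "(\<integral>z. norm (\<Sum>n\<in>{M..<2 * M}. a n * character (real n powr (1 + \<mu>)) (real n powr (1 + \<nu>)) z) ^ 6 \<partial>square_measure)
      \<le> A * B * (\<integral>z. norm (\<Sum>n\<in>{M..<2 * M}. a n * character (real n powr (1 + \<mu>)) (real n powr (1 + \<nu>)) (A * fst z, B * snd z)) ^ 6 \<partial>square_measure)"
      using AB by (intro square_integral_rescale) (auto intro!: continuous_intros)
    also have "(\<lambda>n z. character (real n powr (1 + \<mu>)) (real n powr (1 + \<nu>)) (A * fst z, B * snd z)) = (\<lambda>n. character (\<alpha> n) (\<beta> n))"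
      by (auto simp: fun_eq_iff character_def \<alpha>_def \<beta>_def mult_ac)
    also have "A * B * (\<integral>z. norm (\<Sum>n\<in>{M..<2 * M}. a n * character (\<alpha> n) (\<beta> n) z) ^ 6 \<partial>square_measure) \<le> A * B * (W * (W * K))"
      using rounded AB by (intro mult_left_mono) auto
    also have "A * B * (W * (W * K)) = (W * (W * C)) * (A * B * real M powr \<epsilon>) * m ^ 3" by (simp add: K_def)
    also have "A * B * real M powr \<epsilon> = real M powr (r\<^sub>1 + r\<^sub>2 - 2 - \<mu> - \<nu> + \<epsilon>)"
      unfolding A_def B_def powr_add[symmetric] by (simp add: algebra_simps)
    finally show ?thesis by (simp only: m_def)
  qed
  show ?thesis
    using main by (intro that[of "W * (W * C)"]) (use C in \<open>auto simp: W_def r\<^sub>1_def r\<^sub>2_def\<close>)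
qed

lemma sum_dyadic_blocks:
  fixes f :: "nat \<Rightarrow> 'a::comm_monoid_add"
  shows "(\<Sum>n\<in>{1..<2 ^ K}. f n) = (\<Sum>k<K. \<Sum>n\<in>{2 ^ k..<2 * 2 ^ k}. f n)"
proof (induction K)
  case (Suc K)
  have "(\<Sum>n\<in>{1..<2 ^ Suc K}. f n) = (\<Sum>n\<in>{1..<2 ^ K}. f n) + (\<Sum>n\<in>{2 ^ K..<2 ^ Suc K}. f n)"
    by (rule sum.atLeastLessThan_concat[symmetric]) auto
  thus ?case using Suc.IH by simp
qed simp

text \<open>Absorbs the logarithmic number \<open>Suc j\<close> of dyadic blocks below
  \<open>2 ^ Suc j\<close> into an arbitrarily small power.\<close>

lemma exponential_dominates_linear:
  fixes \<delta> :: real and j :: nat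
  assumes "\<delta> > 0"
  shows "real (Suc j) \<le> (1 + 1 / (\<delta> * ln 2)) * (2 ^ j) powr \<delta>"
proof -
  have l: "\<delta> * ln 2 > 0" using assms by simp
  have "1 + real j * (\<delta> * ln 2) \<le> exp (real j * (\<delta> * ln 2))" by (rule exp_ge_add_one_self)
  also have "\<dots> = (2 ^ j) powr \<delta>" by (simp add: powr_def ln_realpow mult_ac)
  finally have e: "1 + real j * (\<delta> * ln 2) \<le> (2 ^ j) powr \<delta>" .
  have "real (Suc j) = 1 + 1 / (\<delta> * ln 2) * (real j * (\<delta> * ln 2))" using assms by simp
  also have "\<dots> \<le> 1 * (1 + real j * (\<delta> * ln 2)) + 1 / (\<delta> * ln 2) * (1 + real j * (\<delta> * ln 2))"
    using l assms by (intro add_mono mult_left_mono) auto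
  also have "\<dots> = (1 + 1 / (\<delta> * ln 2)) * (1 + real j * (\<delta> * ln 2))" by (simp only: distrib_right)
  also have "\<dots> \<le> (1 + 1 / (\<delta> * ln 2)) * (2 ^ j) powr \<delta>" using e assms by (intro mult_left_mono) auto
  finally show ?thesis .
qed

lemma sextic_estimate:
  fixes \<mu> \<nu> \<epsilon> :: real
  assumes \<mu>\<nu>: "0 < \<mu>" "\<mu> < \<nu>" and \<epsilon>: "\<epsilon> > 0"
  obtains C :: real where "C > 0" "\<And>N a. N \<ge> 1 \<Longrightarrow>
    (\<integral>z. norm (exp_sum \<mu> \<nu> N a z) ^ 6 \<partial>square_measure)
    \<le> C * real N powr (max 2 (1 + \<mu>) + max 2 (1 + \<nu>) - 2 - \<mu> - \<nu> + \<epsilon>) * (\<Sum>n = 1..N. (norm (a n))\<^sup>2) ^ 3"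
proof -
  define \<sigma> where "\<sigma> = max 2 (1 + \<mu>) + max 2 (1 + \<nu>) - 2 - \<mu> - \<nu>"
  have \<sigma>: "\<sigma> \<ge> 0" unfolding \<sigma>_def by linarith
  define \<phi> where "\<phi> = (\<lambda>n::nat. character (real n powr (1 + \<mu>)) (real n powr (1 + \<nu>)))"
  obtain C where C: "C > 0" "\<And>M a. M \<ge> 1 \<Longrightarrow>
    (\<integral>z. norm (\<Sum>n\<in>{M..<2 * M}. a n * \<phi> n z) ^ 6 \<partial>square_measure)
    \<le> C * real M powr (\<sigma> + \<epsilon> / 2) * (\<Sum>n\<in>{M..<2 * M}. (norm (a n))\<^sup>2) ^ 3"
    using dyadic_sextic_estimate[OF \<mu>\<nu> half_gt_zero[OF \<epsilon>]] unfolding \<sigma>_def \<phi>_def by blast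
  \<comment> \<open>The power mean over the dyadic blocks costs the fifth power of their number.
    Bounding this number with exponent \<open>\<epsilon> / 10\<close> spends
    \<open>\<epsilon> / 2\<close>, and the dyadic estimate spends the other half.\<close>
  define D where "D = 1 + 1 / (\<epsilon> / 10 * ln 2)"
  have D: "D > 0" using \<epsilon> by (simp add: D_def add_pos_pos)
  have main: "(\<integral>z. norm (exp_sum \<mu> \<nu> N a z) ^ 6 \<partial>square_measure)
    \<le> (D ^ 5 * C) * real N powr (\<sigma> + \<epsilon>) * (\<Sum>n = 1..N. (norm (a n))\<^sup>2) ^ 3"
    if N: "N \<ge> 1" for N :: nat and a :: "nat \<Rightarrow> complex"
  proof -
    obtain j :: nat where j: "2 ^ j \<le> N" "N < 2 ^ Suc j"
      using ex_power_ivl1[of 2 N] N by auto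
    define K where "K = Suc j"
    \<comment> \<open>Padding by zeros completes the last dyadic block.\<close>
    define a' where "a' = (\<lambda>n. if n \<le> N then a n else 0)"
    define m where "m = (\<lambda>k::nat. \<Sum>n\<in>{2 ^ k..<2 * 2 ^ k}. (norm (a' n))\<^sup>2)"
    define f where "f = (\<lambda>k z. \<Sum>n\<in>{2 ^ k..<2 * 2 ^ k}. a' n * \<phi> n z)"
    have m: "m k \<ge> 0" for k by (auto simp: m_def sum_nonneg)
    have "(\<Sum>n = 1..N. (norm (a n))\<^sup>2) = (\<Sum>n\<in>{1..<2 ^ K}. (norm (a' n))\<^sup>2)"
      using j by (intro sum.mono_neutral_cong_left) (auto simp: a'_def K_def)
    hence mass: "(\<Sum>n = 1..N. (norm (a n))\<^sup>2) = (\<Sum>k<K. m k)"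
      by (simp only: sum_dyadic_blocks m_def)
    have F: "exp_sum \<mu> \<nu> N a z = (\<Sum>k<K. f k z)" for z
    proof -
      have "exp_sum \<mu> \<nu> N a z = (\<Sum>n\<in>{1..<2 ^ K}. a' n * \<phi> n z)"
        unfolding exp_sum_character using j
        by (intro sum.mono_neutral_cong_left) (auto simp: a'_def \<phi>_def K_def)
      thus ?thesis by (simp only: sum_dyadic_blocks f_def)
    qed
    have fint: "integrable square_measure (\<lambda>z. norm (f k z) ^ 6)" for k
      unfolding f_def \<phi>_def by (intro square_integrable_continuous continuous_intros)
    have piece: "(\<integral>z. norm (f k z) ^ 6 \<partial>square_measure) \<le> C * real N powr (\<sigma> + \<epsilon> / 2) * m k ^ 3" if k: "k < K" for k
    proof -
      have "(2::nat) ^ k \<le> 2 ^ j" using k by (intro power_increasing) (auto simp: K_def)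
      hence kN: "2 ^ k \<le> N" using j by linarith
      have "(\<integral>z. norm (f k z) ^ 6 \<partial>square_measure) \<le> C * real (2 ^ k) powr (\<sigma> + \<epsilon> / 2) * m k ^ 3"
        unfolding f_def m_def by (rule C) simp
      also have "\<dots> \<le> C * real N powr (\<sigma> + \<epsilon> / 2) * m k ^ 3"
        using C(1) kN \<sigma> \<epsilon> m by (intro mult_right_mono mult_left_mono powr_mono2) (auto simp flip: of_nat_power)
      finally show ?thesis .
    qed
    have "(\<integral>z. norm (exp_sum \<mu> \<nu> N a z) ^ 6 \<partial>square_measure) \<le> (\<integral>z. real K ^ 5 * (\<Sum>k<K. norm (f k z) ^ 6) \<partial>square_measure)"
    proof (rule integral_mono')
      fix z
      have "norm (exp_sum \<mu> \<nu> N a z) ^ 6 \<le> (\<Sum>k<K. 1 * norm (f k z)) ^ Suc 5"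
        unfolding F by (simp, intro power_mono norm_sum) auto
      also have "\<dots> \<le> (\<Sum>k<K. 1) ^ 5 * (\<Sum>k<K. 1 * norm (f k z) ^ Suc 5)"
        by (rule weighted_power_mean) auto
      finally show "norm (exp_sum \<mu> \<nu> N a z) ^ 6 \<le> real K ^ 5 * (\<Sum>k<K. norm (f k z) ^ 6)" by simp
    qed (use fint in \<open>auto simp: sum_nonneg\<close>)
    also have "\<dots> = real K ^ 5 * (\<Sum>k<K. \<integral>z. norm (f k z) ^ 6 \<partial>square_measure)" using fint by simp
    also have "\<dots> \<le> real K ^ 5 * (\<Sum>k<K. C * real N powr (\<sigma> + \<epsilon> / 2) * m k ^ 3)"
      using piece by (intro mult_left_mono sum_mono) auto
    also have "\<dots> = real K ^ 5 * (C * real N powr (\<sigma> + \<epsilon> / 2)) * (\<Sum>k<K. m k ^ 3)"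
      by (simp add: sum_distrib_left mult.assoc)
    also have "\<dots> \<le> (D ^ 5 * real N powr (\<epsilon> / 2)) * (C * real N powr (\<sigma> + \<epsilon> / 2)) * (\<Sum>k<K. m k) ^ 3"
    proof (intro mult_mono sum_power_le_power_sum mult_right_mono)
      have "real K \<le> D * (2 ^ j) powr (\<epsilon> / 10)"
        unfolding K_def D_def using \<epsilon> by (intro exponential_dominates_linear) auto
      also have "\<dots> \<le> D * real N powr (\<epsilon> / 10)"
        using D \<epsilon> of_nat_mono[OF j(1), where 'a = real] by (intro mult_left_mono powr_mono2) auto
      finally have "real K ^ 5 \<le> (D * real N powr (\<epsilon> / 10)) ^ 5" by (intro power_mono) auto
      also have "\<dots> = D ^ 5 * real N powr (\<epsilon> / 2)"
        using N by (simp add: power_mult_distrib powr_power)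
      finally show "real K ^ 5 \<le> D ^ 5 * real N powr (\<epsilon> / 2)" .
    qed (use C(1) D m in \<open>auto simp: sum_nonneg\<close>)
    also have "\<dots> = (D ^ 5 * C) * real N powr (\<sigma> + \<epsilon>) * (\<Sum>k<K. m k) ^ 3"
    proof -
      have "real N powr (\<epsilon> / 2) * real N powr (\<sigma> + \<epsilon> / 2) = real N powr (\<sigma> + \<epsilon>)"
        unfolding powr_add[symmetric] by (simp add: add.commute add.left_commute)
      thus ?thesis by (simp only: mult_ac flip: \<open>_ = real N powr (\<sigma> + \<epsilon>)\<close>)
    qed
    finally show ?thesis by (simp only: mass)
  qed
  show ?thesis using main by (intro that[of "D ^ 5 * C"]) (use C D in \<open>auto simp: \<sigma>_def\<close>)
qed

section \<open>The second moment and interpolation\<close>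

lemma floor_powr_strict_mono:
  fixes \<mu> :: real and n m :: nat
  assumes "\<mu> > 0" "1 \<le> n" "n < m"
  shows "\<lfloor>real n powr (1 + \<mu>)\<rfloor> < \<lfloor>real m powr (1 + \<mu>)\<rfloor>"
proof -
  \<comment> \<open>The unrounded values already grow by at least 1 from \<open>n\<close> to
    \<open>n + 1\<close>, so their floors stay distinct.\<close>
  have "1 \<le> real n powr \<mu>" using assms by (intro ge_one_powr_ge_zero) auto
  hence "real n powr (1 + \<mu>) + 1 \<le> (real n + 1) * real n powr \<mu>"
    using assms by (simp add: powr_add algebra_simps)
  also have "\<dots> \<le> real m * real m powr \<mu>" using assms by (intro mult_mono powr_mono2) auto
  also have "\<dots> = real m powr (1 + \<mu>)" using assms by (simp add: powr_add)
  finally show ?thesis by linarith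
qed

text \<open>The rounded frequencies in the first variable are pairwise distinct, which alone makes
  the rounded characters orthonormal. \<open>character_rounding\<close> with \<open>k = 1\<close>
  transfers the resulting identity and contributes the constant.\<close>

lemma quadratic_estimate:
  fixes \<mu> \<nu> :: real
  assumes \<mu>: "0 < \<mu>"
  shows "(\<integral>z. norm (exp_sum \<mu> \<nu> N a z) ^ 2 \<partial>square_measure) \<le> exp (2 * pi) ^ 4 * (\<Sum>n = 1..N. (norm (a n))\<^sup>2)"
proof -
  define p q where "p = (\<lambda>n::nat. \<lfloor>real n powr (1 + \<mu>)\<rfloor>)" and "q = (\<lambda>n::nat. \<lfloor>real n powr (1 + \<nu>)\<rfloor>)"
  have "(\<integral>z. norm (\<Sum>n = 1..N. a n * character (real n powr (1 + \<mu>)) (real n powr (1 + \<nu>)) z) ^ Suc 1 \<partial>square_measure)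
    \<le> exp (2 * pi) ^ Suc 1 * (exp (2 * pi) ^ Suc 1 * (\<Sum>n = 1..N. (norm (a n))\<^sup>2))"
  proof (rule character_rounding)
    fix b :: "nat \<Rightarrow> complex" assume b: "\<And>n. norm (b n) \<le> norm (a n)"
    define e where "e = (\<lambda>n z. b n * character (of_int (p n)) (of_int (q n)) z)"
    have e: "e k z * cnj (e l z) = (b k * cnj (b l)) * character (of_int (p k - p l)) (of_int (q k - q l)) z" for k l z
      using character_add[of "of_int (p k)" "- of_int (p l)" "of_int (q k)" "- of_int (q l)" z]
      by (simp add: e_def cnj_character)
    have "(\<integral>z. (norm (\<Sum>n = 1..N. e n z))\<^sup>2 * 1 \<partial>square_measure) = (\<Sum>n = 1..N. \<integral>z. (norm (e n z))\<^sup>2 * 1 \<partial>square_measure)"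
    proof (rule integral_norm_sum_sq_orthogonal)
      fix k l assume kl: "k \<in> {1..N}" "l \<in> {1..N}"
      show "integrable square_measure (\<lambda>z. e k z * cnj (e l z) * of_real 1)"
        unfolding e by (intro square_integrable_continuous continuous_intros)
      assume "k \<noteq> l"
      hence "p k \<noteq> p l"
        using floor_powr_strict_mono[OF \<mu>, of k l] floor_powr_strict_mono[OF \<mu>, of l k] kl
        by (cases "k < l") (auto simp: p_def)
      hence "(\<integral>z. character (of_int (p k - p l)) (of_int (q k - q l)) z \<partial>square_measure) = 0"
        by (intro integral_character) auto
      thus "(\<integral>z. e k z * cnj (e l z) * of_real 1 \<partial>square_measure) = 0" unfolding e by simp
    qed auto
    also have "\<dots> = (\<Sum>n = 1..N. (norm (b n))\<^sup>2)"
      using square_measure_facts(2) by (simp add: e_def norm_mult)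
    also have "\<dots> \<le> (\<Sum>n = 1..N. (norm (a n))\<^sup>2)" using b by (intro sum_mono power_mono) auto
    finally show "(\<integral>z. norm (\<Sum>n = 1..N. b n * character (of_int \<lfloor>real n powr (1 + \<mu>)\<rfloor>) (of_int \<lfloor>real n powr (1 + \<nu>)\<rfloor>) z) ^ Suc 1 \<partial>square_measure)
      \<le> (\<Sum>n = 1..N. (norm (a n))\<^sup>2)"
      by (simp add: e_def p_def q_def eval_nat_numeral)
  qed auto
  thus ?thesis by (simp add: exp_sum_character eval_nat_numeral mult_ac)
qed

lemma exp_sum_sup_bound: "norm (exp_sum \<mu> \<nu> N a z) \<le> sqrt (real N * (\<Sum>n = 1..N. (norm (a n))\<^sup>2))"
proof -
  have "norm (exp_sum \<mu> \<nu> N a z) \<le> (\<Sum>n = 1..N. norm (a n))"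
    unfolding exp_sum_character by (rule sum_norm_le) (simp add: norm_mult)
  also have "\<dots> \<le> sqrt (real N * (\<Sum>n = 1..N. (norm (a n))\<^sup>2))"
    using sum_squared_le_sum_of_squares[of "\<lambda>n. norm (a n)" "{1..N}"]
    by (intro real_le_rsqrt) (simp add: mult.commute)
  finally show ?thesis .
qed

text \<open>Young's inequality, applied pointwise to \<open>h x ^ 2 / U\<close> and
  \<open>h x ^ 6 / V\<close> with weights \<open>1 - \<theta>\<close> and \<theta>, integrates to
  the Hoelder bound, because the normalized integrals are at most 1 and
  \<open>2 * (1 - \<theta>) + 6 * \<theta> = 2 + 4 * \<theta>\<close>.\<close>

lemma integral_powr_interpolate:
  fixes h :: "'x \<Rightarrow> real"
  assumes h: "\<And>x. h x \<ge> 0" and int: "integrable M (\<lambda>x. h x ^ 2)" "integrable M (\<lambda>x. h x ^ 6)"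
    and U: "U > 0" "(\<integral>x. h x ^ 2 \<partial>M) \<le> U" and V: "V > 0" "(\<integral>x. h x ^ 6 \<partial>M) \<le> V"
    and \<theta>: "0 \<le> \<theta>" "\<theta> \<le> 1"
  shows "(\<integral>x. h x powr (2 + 4 * \<theta>) \<partial>M) \<le> U powr (1 - \<theta>) * V powr \<theta>"
proof -
  define c where "c = U powr (1 - \<theta>) * V powr \<theta>"
  have c: "c \<ge> 0" by (simp add: c_def)
  have "(\<integral>x. h x powr (2 + 4 * \<theta>) \<partial>M) \<le> (\<integral>x. c * ((1 - \<theta>) * (h x ^ 2 / U) + \<theta> * (h x ^ 6 / V)) \<partial>M)"
  proof (rule integral_mono')
    show "integrable M (\<lambda>x. c * ((1 - \<theta>) * (h x ^ 2 / U) + \<theta> * (h x ^ 6 / V)))" using int by auto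
    fix x
    show "0 \<le> c * ((1 - \<theta>) * (h x ^ 2 / U) + \<theta> * (h x ^ 6 / V))" using c \<theta> U V h by auto
    show "h x powr (2 + 4 * \<theta>) \<le> c * ((1 - \<theta>) * (h x ^ 2 / U) + \<theta> * (h x ^ 6 / V))"
    proof (cases "h x = 0")
      case False
      with h[of x] have hx: "h x > 0" by linarith
      have "h x powr (2 + 4 * \<theta>) = h x powr (2 * (1 - \<theta>)) * h x powr (6 * \<theta>)"
        by (simp flip: powr_add) (simp add: algebra_simps)
      also have "\<dots> = (h x ^ 2) powr (1 - \<theta>) * (h x ^ 6) powr \<theta>"
        using hx by (simp add: powr_powr flip: powr_numeral)
      also have "\<dots> = c * ((h x ^ 2 / U) powr (1 - \<theta>) * (h x ^ 6 / V) powr \<theta>)"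
        using U V hx by (simp add: c_def powr_divide)
      also have "\<dots> \<le> c * ((1 - \<theta>) * (h x ^ 2 / U) + \<theta> * (h x ^ 6 / V))"
        using c \<theta> hx U V by (intro mult_left_mono Youngs_inequality_0) auto
      finally show ?thesis .
    qed (use c in simp)
  qed
  also have "\<dots> = c * ((1 - \<theta>) * ((\<integral>x. h x ^ 2 \<partial>M) / U) + \<theta> * ((\<integral>x. h x ^ 6 \<partial>M) / V))"
    using int by simp
  also have "\<dots> \<le> c * ((1 - \<theta>) * 1 + \<theta> * 1)"
    using c \<theta> U V by (intro mult_left_mono add_mono) auto
  finally show ?thesis by (simp add: c_def)
qed

theorem theorem1p2:
  fixes \<mu> \<nu> :: real
  assumes "0 < \<mu>" and "\<mu> < \<nu>"
  shows "\<forall>p::real. p \<ge> 2 \<longrightarrow> (\<forall>\<epsilon>::real. \<epsilon> > 0 \<longrightarrow>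
    (\<exists>C::real. C > 0 \<and>
      (\<forall>N::nat. N \<ge> 1 \<longrightarrow> (\<forall>a::nat \<Rightarrow> complex.
        Lp_norm_square p (exp_sum \<mu> \<nu> N a)
          \<le> C * real N powr (E_exponent \<mu> \<nu> p + \<epsilon>)
              * sqrt (\<Sum>n = 1..N. (norm (a n))\<^sup>2)))))"
proof (intro allI impI)
  fix p \<epsilon> :: real assume p: "p \<ge> 2" and \<epsilon>: "\<epsilon> > 0"
  define \<sigma> where "\<sigma> = max 2 (1 + \<mu>) + max 2 (1 + \<nu>) - 2 - \<mu> - \<nu>"
  obtain C6 where C6: "C6 > 0" "\<And>N a. N \<ge> 1 \<Longrightarrow> (\<integral>z. norm (exp_sum \<mu> \<nu> N a z) ^ 6 \<partial>square_measure)
    \<le> C6 * real N powr (\<sigma> + \<epsilon>) * (\<Sum>n = 1..N. (norm (a n))\<^sup>2) ^ 3"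
    using sextic_estimate[OF assms \<epsilon>] unfolding \<sigma>_def by blast
  define C2 where "C2 = exp (2 * pi) ^ 4"
  have C2: "C2 > 0" by (simp add: C2_def)
  have cont: "continuous_on UNIV (exp_sum \<mu> \<nu> N a)" for N a
    unfolding exp_sum_character[abs_def] by (intro continuous_intros)
  have int: "integrable square_measure (\<lambda>z. norm (exp_sum \<mu> \<nu> N a z) ^ k)" for N a k
    by (intro square_integrable_continuous continuous_intros cont)
  have Lp: "Lp_norm_square p f = (\<integral>z. norm (f z) powr p \<partial>square_measure) powr (1 / p)" for f
    by (simp add: Lp_norm_square_def set_integral_unit_square)
  \<comment> \<open>The interpolation divides by its two bounds, which have to be positive;
    vanishing coefficients are therefore treated separately at the end.\<close>
  have pos_case: "\<exists>C>0. \<forall>N::nat. N \<ge> 1 \<longrightarrow> (\<forall>a. (\<Sum>n = 1..N. (norm (a n))\<^sup>2) > 0 \<longrightarrow>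
    (\<integral>z. norm (exp_sum \<mu> \<nu> N a z) powr p \<partial>square_measure)
      \<le> (C * real N powr (E_exponent \<mu> \<nu> p + \<epsilon>) * sqrt (\<Sum>n = 1..N. (norm (a n))\<^sup>2)) powr p)"
  proof (cases "p \<le> 6")
    case True
    define \<theta> where "\<theta> = (p - 2) / 4"
    have \<theta>: "0 \<le> \<theta>" "\<theta> \<le> 1" "2 + 4 * \<theta> = p" using p True by (auto simp: \<theta>_def field_simps)
    define C where "C = (C2 powr (1 - \<theta>) * C6 powr \<theta>) powr (1 / p)"
    have "(\<integral>z. norm (exp_sum \<mu> \<nu> N a z) powr p \<partial>square_measure)
      \<le> (C * real N powr (E_exponent \<mu> \<nu> p + \<epsilon>) * sqrt (\<Sum>n = 1..N. (norm (a n))\<^sup>2)) powr p"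
      if N: "N \<ge> 1" and pos: "(\<Sum>n = 1..N. (norm (a n))\<^sup>2) > 0" for N :: nat and a :: "nat \<Rightarrow> complex"
    proof -
      define m where "m = (\<Sum>n = 1..N. (norm (a n))\<^sup>2)"
      have m: "m > 0" using pos by (simp add: m_def)
      have "(\<integral>z. norm (exp_sum \<mu> \<nu> N a z) powr (2 + 4 * \<theta>) \<partial>square_measure)
        \<le> (C2 * m) powr (1 - \<theta>) * (C6 * real N powr (\<sigma> + \<epsilon>) * m ^ 3) powr \<theta>"
        using C6 C2 N m \<theta> int quadratic_estimate[OF assms(1), of \<nu> N a]
        by (intro integral_powr_interpolate) (auto simp: m_def C2_def)
      also have "\<dots> = (C2 powr (1 - \<theta>) * C6 powr \<theta>) * real N powr (\<theta> * (\<sigma> + \<epsilon>)) * (m powr (1 - \<theta>) * m powr (3 * \<theta>))"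
        using m C2 C6(1) N by (simp add: powr_mult powr_powr mult_ac flip: powr_numeral)
      also have "m powr (1 - \<theta>) * m powr (3 * \<theta>) = m powr (p / 2)"
      proof -
        have "1 - \<theta> + 3 * \<theta> = p / 2" using \<theta>(3) by simp
        thus ?thesis by (simp only: flip: powr_add)
      qed
      also have "(C2 powr (1 - \<theta>) * C6 powr \<theta>) * real N powr (\<theta> * (\<sigma> + \<epsilon>)) * m powr (p / 2)
        \<le> (C2 powr (1 - \<theta>) * C6 powr \<theta>) * real N powr ((E_exponent \<mu> \<nu> p + \<epsilon>) * p) * m powr (p / 2)"
      proof (intro mult_right_mono mult_left_mono powr_mono)
        \<comment> \<open>For the \<open>p\<close>-th power of the norm, the exponent of
          \<open>N\<close> interpolates linearly between 0 at \<open>p = 2\<close> and \<sigma> at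
          \<open>p = 6\<close>.\<close>
        have "E_exponent \<mu> \<nu> p * p = \<theta> * \<sigma>" using True p by (simp add: E_exponent_def \<sigma>_def \<theta>_def)
        moreover have "\<theta> * \<epsilon> \<le> p * \<epsilon>" using \<theta> p \<epsilon> by (intro mult_right_mono) auto
        ultimately show "\<theta> * (\<sigma> + \<epsilon>) \<le> (E_exponent \<mu> \<nu> p + \<epsilon>) * p" by (simp add: algebra_simps)
      qed (use N in auto)
      also have "\<dots> = (C * real N powr (E_exponent \<mu> \<nu> p + \<epsilon>) * sqrt m) powr p"
        using p m by (simp add: C_def powr_mult powr_powr powr_half_sqrt[symmetric])
      finally show ?thesis by (simp add: \<theta>(3) m_def)
    qed
    moreover have "C > 0" using C2 C6(1) by (simp add: C_def)
    ultimately show ?thesis by blast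
  next
    case False
    define C where "C = C6 powr (1 / p)"
    have "(\<integral>z. norm (exp_sum \<mu> \<nu> N a z) powr p \<partial>square_measure)
      \<le> (C * real N powr (E_exponent \<mu> \<nu> p + \<epsilon>) * sqrt (\<Sum>n = 1..N. (norm (a n))\<^sup>2)) powr p"
      if N: "N \<ge> 1" and pos: "(\<Sum>n = 1..N. (norm (a n))\<^sup>2) > 0" for N :: nat and a :: "nat \<Rightarrow> complex"
    proof -
      define m where "m = (\<Sum>n = 1..N. (norm (a n))\<^sup>2)"
      have m: "m > 0" using pos by (simp add: m_def)
      \<comment> \<open>The power \<open>p - 6\<close> of the supremum bound
        \<open>sqrt (N * m)\<close>; only six factors of the integrand are left to the sixth
        moment.\<close>
      define S where "S = (real N * m) powr ((p - 6) / 2)"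
      have "(\<integral>z. norm (exp_sum \<mu> \<nu> N a z) powr p \<partial>square_measure)
        \<le> (\<integral>z. S * norm (exp_sum \<mu> \<nu> N a z) ^ 6 \<partial>square_measure)"
      proof (rule integral_mono')
        fix z
        show "norm (exp_sum \<mu> \<nu> N a z) powr p \<le> S * norm (exp_sum \<mu> \<nu> N a z) ^ 6"
        proof (cases "exp_sum \<mu> \<nu> N a z = 0")
          case nz: False
          have "norm (exp_sum \<mu> \<nu> N a z) powr p
            = norm (exp_sum \<mu> \<nu> N a z) powr (p - 6) * norm (exp_sum \<mu> \<nu> N a z) ^ 6"
            using nz powr_add[of "norm (exp_sum \<mu> \<nu> N a z)" "p - 6" 6] by simp
          also have "\<dots> \<le> sqrt (real N * m) powr (p - 6) * norm (exp_sum \<mu> \<nu> N a z) ^ 6"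
            unfolding m_def using False by (intro mult_right_mono powr_mono2 exp_sum_sup_bound) auto
          also have "sqrt (real N * m) powr (p - 6) = S"
            using m by (simp add: S_def powr_powr powr_half_sqrt[symmetric])
          finally show ?thesis .
        qed (use p in simp)
      qed (use int in \<open>auto simp: S_def\<close>)
      also have "\<dots> \<le> S * (C6 * real N powr (\<sigma> + \<epsilon>) * m ^ 3)"
        using C6(2)[OF N, of a] by (simp add: S_def m_def mult_left_mono)
      also have "\<dots> = C6 * real N powr ((p - 6) / 2 + (\<sigma> + \<epsilon>)) * (m powr ((p - 6) / 2) * m powr 3)"
        using m N by (simp add: S_def powr_mult powr_add)
      also have "m powr ((p - 6) / 2) * m powr 3 = m powr (p / 2)"
        unfolding powr_add[symmetric] by (simp add: field_simps)
      also have "C6 * real N powr ((p - 6) / 2 + (\<sigma> + \<epsilon>)) * m powr (p / 2)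
        \<le> C6 * real N powr ((E_exponent \<mu> \<nu> p + \<epsilon>) * p) * m powr (p / 2)"
      proof (intro mult_right_mono mult_left_mono powr_mono)
        have "E_exponent \<mu> \<nu> p * p = (p - 6) / 2 + \<sigma>"
          using False by (simp add: E_exponent_def \<sigma>_def field_simps)
        moreover have "1 * \<epsilon> \<le> p * \<epsilon>" using p \<epsilon> by (intro mult_right_mono) auto
        ultimately show "(p - 6) / 2 + (\<sigma> + \<epsilon>) \<le> (E_exponent \<mu> \<nu> p + \<epsilon>) * p" by (simp add: algebra_simps)
      qed (use N C6 in auto)
      also have "\<dots> = (C * real N powr (E_exponent \<mu> \<nu> p + \<epsilon>) * sqrt m) powr p"
        using p m C6(1) by (simp add: C_def powr_mult powr_powr powr_half_sqrt[symmetric])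
      finally show ?thesis by (simp add: m_def)
    qed
    moreover have "C > 0" using C6(1) by (simp add: C_def)
    ultimately show ?thesis by blast
  qed
  then obtain C where C: "C > 0" "\<And>(N::nat) a. N \<ge> 1 \<Longrightarrow> (\<Sum>n = 1..N. (norm (a n))\<^sup>2) > 0 \<Longrightarrow>
    (\<integral>z. norm (exp_sum \<mu> \<nu> N a z) powr p \<partial>square_measure)
      \<le> (C * real N powr (E_exponent \<mu> \<nu> p + \<epsilon>) * sqrt (\<Sum>n = 1..N. (norm (a n))\<^sup>2)) powr p"
    by blast
  have "Lp_norm_square p (exp_sum \<mu> \<nu> N a)
    \<le> C * real N powr (E_exponent \<mu> \<nu> p + \<epsilon>) * sqrt (\<Sum>n = 1..N. (norm (a n))\<^sup>2)"
    if N: "N \<ge> 1" for N :: nat and a :: "nat \<Rightarrow> complex"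
  proof (cases "(\<Sum>n = 1..N. (norm (a n))\<^sup>2) > 0")
    case True
    have "Lp_norm_square p (exp_sum \<mu> \<nu> N a)
      \<le> ((C * real N powr (E_exponent \<mu> \<nu> p + \<epsilon>) * sqrt (\<Sum>n = 1..N. (norm (a n))\<^sup>2)) powr p) powr (1 / p)"
      unfolding Lp using C(2)[OF N True] p by (intro powr_mono2) auto
    also have "\<dots> = C * real N powr (E_exponent \<mu> \<nu> p + \<epsilon>) * sqrt (\<Sum>n = 1..N. (norm (a n))\<^sup>2)"
      using p C(1) by (simp add: powr_powr sum_nonneg)
    finally show ?thesis .
  next
    case False
    have "(\<Sum>n = 1..N. (norm (a n))\<^sup>2) \<ge> 0" by (intro sum_nonneg) auto
    with False have "(\<Sum>n = 1..N. (norm (a n))\<^sup>2) = 0" by linarith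
    hence "exp_sum \<mu> \<nu> N a z = 0" for z
      using exp_sum_sup_bound[of \<mu> \<nu> N a z] by simp
    thus ?thesis using C(1) by (simp add: Lp sum_nonneg)
  qed
  with C(1) show "\<exists>C::real. C > 0 \<and> (\<forall>N::nat. N \<ge> 1 \<longrightarrow> (\<forall>a::nat \<Rightarrow> complex.
        Lp_norm_square p (exp_sum \<mu> \<nu> N a)
          \<le> C * real N powr (E_exponent \<mu> \<nu> p + \<epsilon>) * sqrt (\<Sum>n = 1..N. (norm (a n))\<^sup>2)))"
    by blast
qed

end
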